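(* Let $A\in L(X_1;X_2)$ be a bounded complex-linear operator, let $\mathcal E_1$ be a generating set for the $\mathbb R$-cone $K_{\mathbb R,1}\subset X_{\mathbb R,1}$ and let $\mathcal M_2$ be a weak-$*$ generating set for the dual cone $K'_{\mathbb R,2}$ of the $\mathbb R$-cone $K_{\mathbb R,2}\subset X_{\mathbb R,2}$. Let $\mathcal T(A)\subset M_2(\mathbb C)$ be the collection of all matrices $$\begin{pmatrix}\langle m_1,Ae_1\rangle & \langle m_2,Ae_1\rangle\\ \langle m_1,Ae_2\rangle & \langle m_2,Ae_2\rangle\end{pmatrix},\qquad e_1,e_2\in\mathcal E_1,\ m_1,m_2\in\mathcal M_2 .$$ Suppose that $\mathcal E_1$ is Archimedian and that $\mathcal T(A)\subset\Gamma_+(\theta)$ for some $\theta\in[0,1)$. Then $A$ maps $K_{\mathbb C,1}^*$ into $K_{\mathbb C,2}^*$ and the mapping $A:(K_{\mathbb C,1}^*,d_1)\to(K_{\mathbb C,2}^*,d_2)$ is $\eta_1(\theta)$-Lipschitz.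
   Context: For $i=1,2$, $X_{\mathbb R,i}$ is a real Banach space and $X_i=X_{\mathbb R,i}\oplus iX_{\mathbb R,i}$ is a complexification of it (a complex Banach space containing $X_{\mathbb R,i}$ as a closed real subspace with the restricted norm). $X'_{\mathbb R,i}$, $X'_i$ are the topological duals, $\langle\cdot,\cdot\rangle$ the canonical (bilinear) dualities, and real functionals are extended complex-linearly to $X_i$. An $\mathbb R$-cone $K_{\mathbb R}$ in a real Banach space $X_{\mathbb R}$ is a closed subset with $K_{\mathbb R}+K_{\mathbb R}=K_{\mathbb R}$, $\mathbb R_+K_{\mathbb R}=K_{\mathbb R}$, $K_{\mathbb R}\cap -K_{\mathbb R}=\{0\}$. Its dual cone is $K'_{\mathbb R}=\{\ell\in X'_{\mathbb R}:\langle\ell,x\rangle\ge 0\ \forall x\in K_{\mathbb R}\}$. Its canonical complexification and the complexified dual cone are $$K_{\mathbb C}=\{x\in X:\operatorname{Re}\langle\ell_1,x\rangle\overline{\langle\ell_2,x\rangle}\ge 0\ \ \forall\ell_1,\ell_2\in K'_{\mathbb R}\},\qquad K'_{\mathbb C}=\{\mu\in X':\operatorname{Re}\langle\mu,x_1\rangle\overline{\langle\mu,x_2\rangle}\ge 0\ \ \forall x_1,x_2\in K_{\mathbb R}\}.$$ A superscript $*$ on a cone denotes removal of the zero vector. $K_{\mathbb C,i}$ is the complexification of $K_{\mathbb R,i}$. For a set $S$, $\mathbb R_+(S)$ is the set of finite sums $\sum t_ku_k$, $t_k\ge 0$, $u_k\in S$. A generating set $\mathcal E_1$ for $K_{\mathbb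 R,1}$ is a subset of $K_{\mathbb R,1}^*$ with $K_{\mathbb R,1}=\overline{\mathbb R_+(\mathcal E_1)}$; it is Archimedian if for every $x\in K_{\mathbb R,1}^*$ there are $e\in\mathcal E_1$ and $t>0$ with $x-te\in K_{\mathbb R,1}$. A weak-$*$ generating set $\mathcal M_2$ for $K'_{\mathbb R,2}$ is a subset of $K'_{\mathbb R,2}\setminus\{0\}$ such that for every $\mu\in K'_{\mathbb R,2}$, all $y_1,\dots,y_p\in X_2$ and $\epsilon>0$ there is $\ell\in\mathbb R_+(\mathcal M_2)$ with $|\langle\ell,y_k\rangle-\langle\mu,y_k\rangle|<\epsilon$, $k=1,\dots,p$. Projective metric: for $x,y\in K_{\mathbb C}^*$ write $x\succeq y$ iff $|\langle\mu,x\rangle|\ge|\langle\mu,y\rangle|$ for all $\mu\in K'_{\mathbb C}$; put $\beta(x,y)=\inf\{t\ge0: x\preceq ty\}$ ($\inf\emptyset=+\infty$) and $d_{K_{\mathbb C}}(x,y)=\log(\beta(x,y)\beta(y,x))\in[0,+\infty]$. Set $d_i=d_{K_{\mathbb C,i}}$. Matrices: $\overset{\circ}{\Gamma}_+$ is the set of $\begin{pmatrix}a&b\\c&d\end{pmatrix}\in M_2(\mathbb C)$ with $|ad-bc|<\operatorname{Re}(a\bar d+b\bar c)$ and $\operatorname{Re}a\bar b,\operatorname{Re}a\bar c,\operatorname{Re}b\bar d,\operatorname{Re}c\bar d>0$. For $0\le\theta<1$, $\Gamma_+(\theta)$ is the set of those matrices in $\overset{\circ}{\Gamma}_+$ with $\frac{|ad-bc|}{\operatorname{Re}(a\bar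 d+b\bar c)}\le\theta$. Further $\delta_1(\theta)=\log\frac{1+\theta}{1-\theta}$ and $$\eta_1(\theta)=\tanh\frac{9\,\delta_1(\theta)}{4}=\frac{(1+\theta)^{9/2}-(1-\theta)^{9/2}}{(1+\theta)^{9/2}+(1-\theta)^{9/2}}<1.$$ *)

theory Defs
  imports "HOL-Analysis.Analysis"
begin

section \<open>Complex Banach spaces\<close>

class complex_banach = banach +
  fixes scaleC :: "complex \<Rightarrow> 'a \<Rightarrow> 'a"  (infixr "*\<^sub>C" 75)
  assumes scaleC_add_right: "c *\<^sub>C (x + y) = c *\<^sub>C x + c *\<^sub>C y"
    and scaleC_add_left: "(c + d) *\<^sub>C x = c *\<^sub>C x + d *\<^sub>C x"
    and scaleC_scaleC: "c *\<^sub>C d *\<^sub>C x = (c * d) *\<^sub>C x"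
    and scaleC_of_real: "complex_of_real r *\<^sub>C x = r *\<^sub>R x"
    and norm_scaleC: "norm (c *\<^sub>C x) = cmod c * norm x"

instantiation complex :: complex_banach
begin

definition scaleC_complex_def: "c *\<^sub>C z = c * z" for z :: complex

instance
  by standard (simp_all add: scaleC_complex_def algebra_simps scaleR_conv_of_real norm_mult)

end

definition bounded_clinear :: "('a::complex_banach \<Rightarrow> 'b::complex_banach) \<Rightarrow> bool" where
  "bounded_clinear f \<longleftrightarrow> bounded_linear f \<and> (\<forall>c x. f (c *\<^sub>C x) = c *\<^sub>C f x)"


section \<open>Complexifications\<close>

text \<open>
  The inclusion of the real space in its complexification is an explicit isometric real-linear
  map \<open>\<iota>\<close>. Its range is automatically closed, because the real space is complete.
\<close>

definition complexification :: "('r::banach \<Rightarrow> 'c::complex_banach) \<Rightarrow> bool" where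
  "complexification \<iota> \<longleftrightarrow>
     linear \<iota> \<and> (\<forall>u. norm (\<iota> u) = norm u) \<and>
     (\<forall>x. \<exists>!p. x = \<iota> (fst p) + \<i> *\<^sub>C \<iota> (snd p))"

text \<open>The complex-linear extension of a real functional to the complexification.\<close>

definition pairing :: "('r::banach \<Rightarrow> 'c::complex_banach) \<Rightarrow> ('r \<Rightarrow>\<^sub>L real) \<Rightarrow> 'c \<Rightarrow> complex" where
  "pairing \<iota> l x =
     (THE z. \<exists>u v. x = \<iota> u + \<i> *\<^sub>C \<iota> v \<and>
        z = complex_of_real (blinfun_apply l u) + \<i> * complex_of_real (blinfun_apply l v))"


section \<open>Real cones and their complexifications\<close>

definition real_cone :: "'r::banach set \<Rightarrow> bool" where
  "real_cone K \<longleftrightarrow>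
     closed K \<and>
     {x + y |x y. x \<in> K \<and> y \<in> K} = K \<and>
     {t *\<^sub>R x |t x. 0 \<le> t \<and> x \<in> K} = K \<and>
     K \<inter> uminus ` K = {0}"

definition dual_cone :: "'r::banach set \<Rightarrow> ('r \<Rightarrow>\<^sub>L real) set" where
  "dual_cone K = {l. \<forall>x\<in>K. 0 \<le> blinfun_apply l x}"

definition cone_complexification :: "('r::banach \<Rightarrow> 'c::complex_banach) \<Rightarrow> 'r set \<Rightarrow> 'c set" where
  "cone_complexification \<iota> K =
     {x. \<forall>l1\<in>dual_cone K. \<forall>l2\<in>dual_cone K. 0 \<le> Re (pairing \<iota> l1 x * cnj (pairing \<iota> l2 x))}"

definition complex_dual_cone ::
    "('r::banach \<Rightarrow> 'c::complex_banach) \<Rightarrow> 'r set \<Rightarrow> ('c \<Rightarrow> complex) set" where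
  "complex_dual_cone \<iota> K =
     {\<mu>. bounded_clinear \<mu> \<and> (\<forall>x1\<in>K. \<forall>x2\<in>K. 0 \<le> Re (\<mu> (\<iota> x1) * cnj (\<mu> (\<iota> x2))))}"


section \<open>Generating sets\<close>

definition nonneg_combinations :: "'v::real_vector set \<Rightarrow> 'v set" where
  "nonneg_combinations S =
     {\<Sum>u\<in>F. t u *\<^sub>R u |F t. finite F \<and> F \<subseteq> S \<and> (\<forall>u\<in>F. 0 \<le> (t u :: real))}"

definition generating_set :: "'r::banach set \<Rightarrow> 'r set \<Rightarrow> bool" where
  "generating_set K E \<longleftrightarrow> E \<subseteq> K - {0} \<and> K = closure (nonneg_combinations E)"

definition archimedian :: "'r::banach set \<Rightarrow> 'r set \<Rightarrow> bool" where
  "archimedian K E \<longleftrightarrow> (\<forall>x\<in>K - {0}. \<exists>e\<in>E. \<exists>t>0. x - t *\<^sub>R e \<in> K)"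

definition weak_star_generating_set ::
    "('r::banach \<Rightarrow> 'c::complex_banach) \<Rightarrow> 'r set \<Rightarrow> ('r \<Rightarrow>\<^sub>L real) set \<Rightarrow> bool" where
  "weak_star_generating_set \<iota> K M \<longleftrightarrow>
     M \<subseteq> dual_cone K - {0} \<and>
     (\<forall>\<mu>\<in>dual_cone K. \<forall>Y. finite Y \<longrightarrow> (\<forall>\<epsilon>>0. \<exists>l\<in>nonneg_combinations M.
        \<forall>y\<in>Y. cmod (pairing \<iota> l y - pairing \<iota> \<mu> y) < \<epsilon>))"


section \<open>The projective metric\<close>

definition cone_le ::
    "('r::banach \<Rightarrow> 'c::complex_banach) \<Rightarrow> 'r set \<Rightarrow> 'c \<Rightarrow> 'c \<Rightarrow> bool" where
  "cone_le \<iota> K x y \<longleftrightarrow> (\<forall>\<mu>\<in>complex_dual_cone \<iota> K. cmod (\<mu> x) \<le> cmod (\<mu> y))"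

definition cone_beta ::
    "('r::banach \<Rightarrow> 'c::complex_banach) \<Rightarrow> 'r set \<Rightarrow> 'c \<Rightarrow> 'c \<Rightarrow> ereal" where
  "cone_beta \<iota> K x y = Inf {ereal t |t. 0 \<le> t \<and> cone_le \<iota> K x (t *\<^sub>R y)}"

definition log_ereal :: "ereal \<Rightarrow> ereal" where
  "log_ereal p = (if p = \<infinity> then \<infinity> else if p \<le> 0 then - \<infinity> else ereal (ln (real_of_ereal p)))"

text \<open>
  For a real cone \<open>K\<close> the functionals in \<open>complex_dual_cone \<iota> K\<close> separate points, so
  \<open>cone_beta\<close> is strictly positive on nonzero vectors and no product of 0 and infinity arises there.
\<close>

definition projective_dist ::
    "('r::banach \<Rightarrow> 'c::complex_banach) \<Rightarrow> 'r set \<Rightarrow> 'c \<Rightarrow> 'c \<Rightarrow> ereal" where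
  "projective_dist \<iota> K x y = log_ereal (cone_beta \<iota> K x y * cone_beta \<iota> K y x)"


section \<open>Matrices\<close>

definition Gamma_plus_int :: "(complex^2^2) set" where
  "Gamma_plus_int = {M. let a = M$1$1; b = M$1$2; c = M$2$1; d = M$2$2 in
     cmod (a * d - b * c) < Re (a * cnj d + b * cnj c) \<and>
     0 < Re (a * cnj b) \<and> 0 < Re (a * cnj c) \<and> 0 < Re (b * cnj d) \<and> 0 < Re (c * cnj d)}"

definition Gamma_plus :: "real \<Rightarrow> (complex^2^2) set" where
  "Gamma_plus \<theta> = {M \<in> Gamma_plus_int. let a = M$1$1; b = M$1$2; c = M$2$1; d = M$2$2 in
     cmod (a * d - b * c) / Re (a * cnj d + b * cnj c) \<le> \<theta>}"

definition delta1 :: "real \<Rightarrow> real" where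
  "delta1 \<theta> = ln ((1 + \<theta>) / (1 - \<theta>))"

definition eta1 :: "real \<Rightarrow> real" where
  "eta1 \<theta> = tanh (9 * delta1 \<theta> / 4)"

definition test_matrices ::
    "('r1::banach \<Rightarrow> 'c1::complex_banach) \<Rightarrow> ('r2::banach \<Rightarrow> 'c2::complex_banach) \<Rightarrow>
     ('c1 \<Rightarrow> 'c2) \<Rightarrow> 'r1 set \<Rightarrow> ('r2 \<Rightarrow>\<^sub>L real) set \<Rightarrow> (complex^2^2) set" where
  "test_matrices \<iota>1 \<iota>2 A E M =
     {vector [vector [pairing \<iota>2 m1 (A (\<iota>1 e1)), pairing \<iota>2 m2 (A (\<iota>1 e1))],
              vector [pairing \<iota>2 m1 (A (\<iota>1 e2)), pairing \<iota>2 m2 (A (\<iota>1 e2))]]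
      |e1 e2 m1 m2. e1 \<in> E \<and> e2 \<in> E \<and> m1 \<in> M \<and> m2 \<in> M}"

end

theory Submission
  imports Defs
begin

text \<open>
  The argument is Birkhoff's contraction theorem in a complex setting. It has two parts.

  The first part bounds the projective diameter of the image of the complexified cone \<open>K\<^sub>1\<close>. For single
  test matrices, \<open>Gamma_entries_cross_ratio\<close> says that vectors \<open>x, y\<close> in the complexification of the cone of two
  generators and functionals \<open>\<mu>, \<nu>\<close> in that of two generators of the dual cone satisfy
  \<open>|\<mu> (A x) \<nu> (A y)| \<le> D |\<nu> (A x) \<mu> (A y)|\<close> with \<open>D = (1 + \<theta>) / (1 - \<theta>)\<close>. In the half-plane picture \<open>ln D\<close> bounds the
  hyperbolic diameter of the disc onto which the matrix maps the right half-plane. General vectors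
  are reduced to pairs of generators by \<open>kernel_meets_edge\<close>: a complex functional that vanishes
  somewhere on the complexified cone also vanishes on the complexification of the cone of some two
  generators. For fixed functionals the values of \<open>\<mu> (A x) / \<nu> (A x)\<close> therefore fill a union of discs, one for
  each pair of generators. Each of them has radial spread at most \<open>D\<close>, and so has each set of values at two generators;
  the whole union has spread at most \<open>D\<^sup>3\<close>. The same reduction for functionals, followed by weak-* limits,
  replaces \<open>D\<^sup>3\<close> by \<open>D\<^sup>9\<close> in \<open>cone_cross_ratio\<close>. The nonvanishing statements on the way also show that
  \<open>A\<close> maps the complexified cone without 0 into the other one.

  The second part turns the diameter bound \<open>\<Delta> = 9 * delta1 \<theta>\<close> into the Lipschitz constant \<open>tanh (\<Delta> / 4)\<close>. If the distance
  of \<open>x\<close> and \<open>y\<close> is finite, then by \<open>pencil_in_cone\<close> all vectors \<open>x - z y\<close> with \<open>z\<close> outside a certain annulus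
  lie in the complexified cone. Applying the diameter bound to the images of two of them, with phases adapted to
  two given functionals, bounds by \<open>\<Delta>\<close> the Hilbert distance of two points in a real interval
  whose ends are the radii of the annulus. The claim follows from \<open>interval_hilbert_contraction\<close>.

  Both parts rest on the descriptions of the complexified cone as \<open>\<complex> (K + i K)\<close> and of the complex dual cone as
  \<open>\<complex> (K' + i K')\<close>. They follow by a rotation of sectors from the separation theorem \<open>cone_separation\<close>, a form of
  the Hahn-Banach theorem. Real functionals extend continuously to the complexification by the bounded
  inverse theorem.
\<close>

section \<open>Positive two-by-two matrices\<close>

text \<open>
  The nonzero vectors of the canonical complexification of the quadrant in \<open>\<real>\<^sup>2\<close>. In the coordinate
  \<open>z / w\<close> they form the closed right half-plane of the Riemann sphere.
\<close>

definition half_plane_pair :: "complex \<Rightarrow> complex \<Rightarrow> bool" where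
  "half_plane_pair z w \<longleftrightarrow> 0 \<le> Re (z * cnj w) \<and> (z \<noteq> 0 \<or> w \<noteq> 0)"

text \<open>
  In affine coordinates \<open>z = - \<beta> / \<alpha>\<close>, \<open>z' = - \<beta>' / \<alpha>'\<close> lie in the left half-plane and
  \<open>s' = u' / v'\<close> in the right one. With \<open>s = u / v\<close> the claim compares \<open>|s + cnj s'| |z - z'|\<close> with
  \<open>|s - z| |s' - z'| + |s' - z| |s - z'|\<close>. Reflecting \<open>s'\<close> in the imaginary axis brings it closer to \<open>z\<close>
  and \<open>z'\<close>; after the reflection the claim is Ptolemy's inequality for the four points \<open>s\<close>,
  \<open>- cnj s'\<close>, \<open>z\<close>, \<open>z'\<close>.
\<close>

lemma ptolemy_half_plane:
  assumes "0 \<le> Re (\<alpha> * cnj \<beta>)" and "0 \<le> Re (\<alpha>' * cnj \<beta>')"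
    and "0 \<le> Re (u' * cnj v')"
  shows "cmod (\<alpha> * \<beta>' - \<alpha>' * \<beta>) * cmod (u * cnj v' + cnj u' * v)
    \<le> cmod ((\<alpha> * u + \<beta> * v) * (\<alpha>' * u' + \<beta>' * v'))
      + cmod ((\<alpha> * u' + \<beta> * v') * (\<alpha>' * u + \<beta>' * v))"
proof -
  have refl: "cmod (- c * cnj u' + d * cnj v') \<le> cmod (c * u' + d * v')"
    if "0 \<le> Re (c * cnj d)" for c d
  proof -
    have "(cmod (c * u' + d * v'))\<^sup>2 - (cmod (- c * cnj u' + d * cnj v'))\<^sup>2
        = 4 * (Re (c * cnj d) * Re (u' * cnj v'))"
      unfolding cmod_power2 by (simp add: algebra_simps power2_eq_square)
    also have "\<dots> \<ge> 0" using that assms(3) by simp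
    finally have "(cmod (- c * cnj u' + d * cnj v'))\<^sup>2 \<le> (cmod (c * u' + d * v'))\<^sup>2" by linarith
    thus ?thesis by (rule power2_le_imp_le) simp
  qed
  have "(\<alpha> * \<beta>' - \<alpha>' * \<beta>) * (u * cnj v' + cnj u' * v)
      = (\<alpha> * u + \<beta> * v) * (- \<alpha>' * cnj u' + \<beta>' * cnj v')
        - (- \<alpha> * cnj u' + \<beta> * cnj v') * (\<alpha>' * u + \<beta>' * v)"
    by (simp add: algebra_simps)
  hence "cmod (\<alpha> * \<beta>' - \<alpha>' * \<beta>) * cmod (u * cnj v' + cnj u' * v)
      \<le> cmod (\<alpha> * u + \<beta> * v) * cmod (- \<alpha>' * cnj u' + \<beta>' * cnj v')
        + cmod (- \<alpha> * cnj u' + \<beta> * cnj v') * cmod (\<alpha>' * u + \<beta>' * v)"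
    by (metis norm_mult norm_triangle_ineq4)
  also have "\<dots> \<le> cmod (\<alpha> * u + \<beta> * v) * cmod (\<alpha>' * u' + \<beta>' * v')
        + cmod (\<alpha> * u' + \<beta> * v') * cmod (\<alpha>' * u + \<beta>' * v)"
    using refl[OF assms(1)] refl[OF assms(2)]
    by (intro add_mono mult_left_mono mult_right_mono) auto
  finally show ?thesis by (simp add: norm_mult)
qed

text \<open>
  If the determinant is smaller in modulus than \<open>\<sigma>\<close>, the identity bounds \<open>\<tau>\<^sup>2\<close> by the product on the right;
  this makes the part of the form of the matrix without \<open>\<sigma>\<close> positive definite.
\<close>

lemma Gamma_disc_identity:
  fixes a b c d :: complex
  defines "\<sigma> \<equiv> Re (a * cnj d + b * cnj c)" and "\<tau> \<equiv> Im (a * cnj d + b * cnj c)"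
  shows "\<sigma>\<^sup>2 + \<tau>\<^sup>2 = (cmod (a * d - b * c))\<^sup>2 + 2 * Re (a * cnj b) * (2 * Re (c * cnj d))"
  unfolding assms cmod_power2 by (simp add: algebra_simps power2_eq_square)

text \<open>
  A Hermitian form on \<open>\<complex>\<^sup>2\<close>. The transpose of the matrix with rows \<open>a, b\<close> and \<open>c, d\<close> pulls the form \<open>u * cnj v' + cnj u' * v\<close>,
  whose nonnegative vectors make up the complexified quadrant, back to such a form.
\<close>

definition hform :: "real \<Rightarrow> real \<Rightarrow> complex \<Rightarrow> complex \<Rightarrow> complex \<Rightarrow> complex \<Rightarrow> complex \<Rightarrow> complex" where
  "hform P Q S x1 x2 y1 y2 = of_real P * x1 * cnj y1 + of_real Q * x2 * cnj y2
     + S * x1 * cnj y2 + cnj S * x2 * cnj y1"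

text \<open>
  Completing the square: the form has determinant \<open>P * Q - \<tau>\<^sup>2\<close>.
\<close>

lemma hform_imag_pos:
  assumes "\<tau>\<^sup>2 < P * Q" "0 < P" "0 < Q" "x1 \<noteq> 0 \<or> x2 \<noteq> 0"
  shows "0 < Re (hform P Q (\<i> * of_real \<tau>) x1 x2 x1 x2)"
proof -
  have "P * Re (hform P Q (\<i> * of_real \<tau>) x1 x2 x1 x2)
      = (P * Re x1 + \<tau> * Im x2)\<^sup>2 + (P * Im x1 - \<tau> * Re x2)\<^sup>2 + (P * Q - \<tau>\<^sup>2) * (cmod x2)\<^sup>2"
    unfolding hform_def cmod_power2 by (simp add: algebra_simps power2_eq_square)
  also have "\<dots> > 0"
  proof (cases "x2 = 0")
    case True
    hence "x1 \<noteq> 0" using assms by simp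
    hence "0 < (Re x1)\<^sup>2 + (Im x1)\<^sup>2"
      by (metis complex_eq_0 complex_eq_iff sum_power2_gt_zero_iff zero_complex.sel)
    hence "0 < P\<^sup>2 * ((Re x1)\<^sup>2 + (Im x1)\<^sup>2)" using assms by simp
    thus ?thesis using True by (simp add: algebra_simps power_mult_distrib)
  next
    case False
    hence "(P * Q - \<tau>\<^sup>2) * (cmod x2)\<^sup>2 > 0" using assms by simp
    thus ?thesis by (simp add: add_nonneg_pos)
  qed
  finally show ?thesis using assms(2) by (simp add: zero_less_mult_iff)
qed

text \<open>
  Split the form as \<open>K + \<sigma> J\<close>, where \<open>K\<close> is positive definite and \<open>J\<close> defines the complexified quadrant.
  On that quadrant \<open>|J(x,y)|\<close> dominates the determinant of \<open>x\<close> and \<open>y\<close>, and the term \<open>K\<close> does no harm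
  because the cross term \<open>Re (K(x,y) cnj J(x,y))\<close> is a combination of \<open>K(x,x)\<close> and \<open>K(y,y)\<close> with
  nonnegative coefficients.
\<close>

lemma hform_bound:
  assumes "\<tau>\<^sup>2 < P * Q" "0 < P" "0 < Q" "0 \<le> \<sigma>"
    and x: "half_plane_pair x1 x2" and y: "half_plane_pair y1 y2"
  shows "\<sigma> * cmod (x1 * y2 - y1 * x2) \<le> cmod (hform P Q (Complex \<sigma> \<tau>) x1 x2 y1 y2)"
proof -
  define K where "K = hform P Q (\<i> * of_real \<tau>) x1 x2 y1 y2"
  define J where "J = x1 * cnj y2 + x2 * cnj y1"
  have H: "hform P Q (Complex \<sigma> \<tau>) x1 x2 y1 y2 = K + of_real \<sigma> * J"
    unfolding hform_def K_def J_def complex_eq_iff by (simp add: algebra_simps)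
  have "Re (K * cnj J) = Re (y1 * cnj y2) * Re (hform P Q (\<i> * of_real \<tau>) x1 x2 x1 x2)
      + Re (x1 * cnj x2) * Re (hform P Q (\<i> * of_real \<tau>) y1 y2 y1 y2)"
    unfolding K_def J_def hform_def by (simp add: algebra_simps power2_eq_square)
  also have "\<dots> \<ge> 0"
    using hform_imag_pos[OF assms(1-3), of x1 x2] hform_imag_pos[OF assms(1-3), of y1 y2] x y
    unfolding half_plane_pair_def by (intro add_nonneg_nonneg mult_nonneg_nonneg) auto
  finally have KJ: "0 \<le> Re (K * cnj J)" .
  have "(cmod J)\<^sup>2 - (cmod (x1 * y2 - y1 * x2))\<^sup>2 = 4 * (Re (x1 * cnj x2) * Re (y1 * cnj y2))"
    unfolding J_def cmod_power2 by (simp add: algebra_simps power2_eq_square)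
  also have "\<dots> \<ge> 0" using x y unfolding half_plane_pair_def by simp
  finally have J: "(cmod (x1 * y2 - y1 * x2))\<^sup>2 \<le> (cmod J)\<^sup>2" by simp
  have "(\<sigma> * cmod (x1 * y2 - y1 * x2))\<^sup>2 \<le> \<sigma>\<^sup>2 * (cmod J)\<^sup>2"
    using J by (simp add: power_mult_distrib mult_left_mono)
  also have "\<dots> \<le> (cmod K)\<^sup>2 + \<sigma>\<^sup>2 * (cmod J)\<^sup>2 + 2 * \<sigma> * Re (K * cnj J)"
    using KJ assms(4) by simp
  also have "\<dots> = (cmod (K + of_real \<sigma> * J))\<^sup>2"
    unfolding cmod_power2 by (simp add: algebra_simps power2_eq_square)
  finally have "(\<sigma> * cmod (x1 * y2 - y1 * x2))\<^sup>2 \<le> (cmod (K + of_real \<sigma> * J))\<^sup>2" .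
  thus ?thesis unfolding H by (rule power2_le_imp_le) simp
qed

text \<open>
  The conditions on the matrices in terms of the four entries; the quotient in the condition on \<open>\<theta>\<close> is
  multiplied out.
\<close>

definition Gamma_int_entries :: "complex \<Rightarrow> complex \<Rightarrow> complex \<Rightarrow> complex \<Rightarrow> bool" where
  "Gamma_int_entries a b c d \<longleftrightarrow> cmod (a * d - b * c) < Re (a * cnj d + b * cnj c) \<and>
     0 < Re (a * cnj b) \<and> 0 < Re (a * cnj c) \<and> 0 < Re (b * cnj d) \<and> 0 < Re (c * cnj d)"

definition Gamma_entries :: "real \<Rightarrow> complex \<Rightarrow> complex \<Rightarrow> complex \<Rightarrow> complex \<Rightarrow> bool" where
  "Gamma_entries \<theta> a b c d \<longleftrightarrow> Gamma_int_entries a b c d \<and>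
     cmod (a * d - b * c) \<le> \<theta> * Re (a * cnj d + b * cnj c)"

lemma Gamma_int_entries_transpose:
  "Gamma_int_entries a b c d \<Longrightarrow> Gamma_int_entries a c b d"
  unfolding Gamma_int_entries_def by (simp add: mult.commute)

lemma Gamma_int_entries_im:
  assumes "Gamma_int_entries a b c d"
  shows "(Im (a * cnj d + b * cnj c))\<^sup>2 < 2 * Re (a * cnj b) * (2 * Re (c * cnj d))"
proof -
  have "(cmod (a * d - b * c))\<^sup>2 < (Re (a * cnj d + b * cnj c))\<^sup>2"
    using assms unfolding Gamma_int_entries_def by (intro power_strict_mono) auto
  thus ?thesis using Gamma_disc_identity[of a d b c] by linarith
qed

lemma Gamma_hform:
  "(a * x1 + c * x2) * cnj (b * y1 + d * y2) + cnj (a * y1 + c * y2) * (b * x1 + d * x2)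
   = hform (2 * Re (a * cnj b)) (2 * Re (c * cnj d)) (a * cnj d + b * cnj c) x1 x2 y1 y2"
  unfolding hform_def complex_eq_iff by (simp add: algebra_simps)

text \<open>
  The transpose of a matrix of this kind maps the complexified quadrant into its interior: the form that defines the
  quadrant pulls back to \<open>K + \<sigma> J\<close> with \<open>K\<close> positive definite and \<open>\<sigma> > 0\<close>.
\<close>

lemma Gamma_int_entries_maps:
  assumes G: "Gamma_int_entries a b c d" and x: "half_plane_pair x1 x2"
  shows "0 < Re ((a * x1 + c * x2) * cnj (b * x1 + d * x2))"
proof -
  let ?S = "a * cnj d + b * cnj c" and ?P = "2 * Re (a * cnj b)" and ?Q = "2 * Re (c * cnj d)"
  have pos: "0 < ?P" "0 < ?Q" "0 < Re ?S"
    using G norm_ge_zero[of "a * d - b * c"] unfolding Gamma_int_entries_def by linarith+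
  have "2 * Re ((a * x1 + c * x2) * cnj (b * x1 + d * x2))
      = Re (hform ?P ?Q ?S x1 x2 x1 x2)"
    unfolding Gamma_hform[symmetric] by (simp add: algebra_simps)
  also have "\<dots> = Re (hform ?P ?Q (\<i> * of_real (Im ?S)) x1 x2 x1 x2) + 2 * Re ?S * Re (x1 * cnj x2)"
    unfolding hform_def by (simp add: algebra_simps)
  also have "\<dots> > 0"
    using hform_imag_pos[OF Gamma_int_entries_im[OF G] pos(1,2), of x1 x2] pos x
    unfolding half_plane_pair_def by (intro add_pos_nonneg) auto
  finally show ?thesis by simp
qed

text \<open>
  A zero would give \<open>u / v = - \<beta> / \<alpha>\<close>, with the left side in the open right half-plane and the right side
  in the closed left one.
\<close>

lemma half_plane_pair_combination_nonzero:
  assumes "0 < Re (u * cnj v)" "half_plane_pair \<alpha> \<beta>"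
  shows "\<alpha> * u + \<beta> * v \<noteq> 0"
proof
  assume eq: "\<alpha> * u + \<beta> * v = 0"
  have uv: "u \<noteq> 0" "v \<noteq> 0" using assms(1) by auto
  have "\<alpha> * u = - (\<beta> * v)" using eq by (simp add: eq_neg_iff_add_eq_0)
  hence "(\<alpha> * u) * cnj (\<beta> * v) = - (\<beta> * v) * cnj (\<beta> * v)" by simp
  also have "\<dots> = - of_real ((cmod (\<beta> * v))\<^sup>2)" by (simp only: mult_minus_left complex_norm_square)
  finally have e1: "(\<alpha> * cnj \<beta>) * (u * cnj v) = - of_real ((cmod (\<beta> * v))\<^sup>2)"
    by (simp add: mult_ac)
  have "Re (\<alpha> * cnj \<beta>) * (cmod (u * cnj v))\<^sup>2 = Re ((\<alpha> * cnj \<beta>) * (u * cnj v) * cnj (u * cnj v))"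
    unfolding mult.assoc[of "\<alpha> * cnj \<beta>"] complex_norm_square[symmetric] by simp
  hence "Re (\<alpha> * cnj \<beta>) * (cmod (u * cnj v))\<^sup>2 = - ((cmod (\<beta> * v))\<^sup>2 * Re (u * cnj v))"
    unfolding e1 by simp
  moreover have "0 \<le> Re (\<alpha> * cnj \<beta>) * (cmod (u * cnj v))\<^sup>2"
    using assms(2) unfolding half_plane_pair_def by simp
  ultimately have "(cmod (\<beta> * v))\<^sup>2 * Re (u * cnj v) \<le> 0" by linarith
  hence "\<beta> = 0" using assms(1) uv by (simp add: mult_le_0_iff)
  with eq uv assms(2) show False unfolding half_plane_pair_def by simp
qed

text \<open>
  The image of the complexified quadrant has projective diameter at most \<open>ln ((1 + \<theta>) / (1 - \<theta>))\<close>.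
  In the half-plane picture the image is a disc, and the number bounds its hyperbolic diameter. With \<open>p\<close> and \<open>q\<close>
  for the two products, \<open>p - q\<close> factors into the determinant of the matrix, that of \<open>\<alpha>\<close> and \<open>\<beta>\<close> and
  that of \<open>x\<close> and \<open>y\<close>. The bound on the form turns the determinant of \<open>x\<close> and \<open>y\<close> into a value of the form, the
  Ptolemy inequality absorbs that of \<open>\<alpha>\<close> and \<open>\<beta>\<close>, and what remains is \<open>|p - q| \<le> \<theta> (|p| + |q|)\<close>.
\<close>

lemma Gamma_entries_cross_ratio:
  assumes G: "Gamma_entries \<theta> a b c d" and \<theta>: "0 \<le> \<theta>" "\<theta> < 1"
    and x: "half_plane_pair x1 x2" and y: "half_plane_pair y1 y2"
    and \<alpha>: "half_plane_pair \<alpha>1 \<alpha>2" and \<beta>: "half_plane_pair \<beta>1 \<beta>2"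
  defines "B \<equiv> \<lambda>x1 x2 \<alpha>1 \<alpha>2. \<alpha>1 * (a * x1 + c * x2) + \<alpha>2 * (b * x1 + d * x2)"
  shows "cmod (B x1 x2 \<alpha>1 \<alpha>2 * B y1 y2 \<beta>1 \<beta>2)
    \<le> (1 + \<theta>) / (1 - \<theta>) * cmod (B x1 x2 \<beta>1 \<beta>2 * B y1 y2 \<alpha>1 \<alpha>2)"
proof -
  let ?S = "a * cnj d + b * cnj c" and ?P = "2 * Re (a * cnj b)" and ?Q = "2 * Re (c * cnj d)"
  let ?A = "\<alpha>1 * \<beta>2 - \<beta>1 * \<alpha>2" and ?X = "x1 * y2 - y1 * x2" and ?D = "a * d - b * c"
  define p where "p = B x1 x2 \<alpha>1 \<alpha>2 * B y1 y2 \<beta>1 \<beta>2"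
  define q where "q = B x1 x2 \<beta>1 \<beta>2 * B y1 y2 \<alpha>1 \<alpha>2"
  have Gi: "Gamma_int_entries a b c d" and Gt: "cmod ?D \<le> \<theta> * Re ?S"
    using G unfolding Gamma_entries_def by auto
  have pos: "0 < ?P" "0 < ?Q" "0 < Re ?S"
    using Gi norm_ge_zero[of ?D] unfolding Gamma_int_entries_def by linarith+
  have "Re ?S * cmod ?X \<le> cmod (hform ?P ?Q (Complex (Re ?S) (Im ?S)) x1 x2 y1 y2)"
    using hform_bound[OF Gamma_int_entries_im[OF Gi] pos(1,2) _ x y] pos(3) by simp
  hence hb: "Re ?S * cmod ?X \<le> cmod (hform ?P ?Q ?S x1 x2 y1 y2)" by (simp only: complex_surj)
  have "cmod (p - q) = cmod (?A * ?D * ?X)"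
    unfolding p_def q_def B_def by (rule arg_cong[of _ _ cmod]) (simp add: algebra_simps)
  also have "\<dots> = cmod ?A * (cmod ?D * cmod ?X)" by (simp add: norm_mult)
  also have "\<dots> \<le> cmod ?A * (\<theta> * Re ?S * cmod ?X)"
    using Gt by (intro mult_left_mono mult_right_mono) auto
  also have "\<dots> \<le> \<theta> * (cmod ?A * cmod (hform ?P ?Q ?S x1 x2 y1 y2))"
    using mult_left_mono[OF hb, of "\<theta> * cmod ?A"] \<theta>(1) by (simp add: mult_ac)
  also have "\<dots> \<le> \<theta> * (cmod p + cmod q)"
  proof (rule mult_left_mono[OF _ \<theta>(1)])
    show "cmod ?A * cmod (hform ?P ?Q ?S x1 x2 y1 y2) \<le> cmod p + cmod q"
      using ptolemy_half_plane[of \<alpha>1 \<alpha>2 \<beta>1 \<beta>2 "a * y1 + c * y2" "b * y1 + d * y2"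
          "a * x1 + c * x2" "b * x1 + d * x2"] \<alpha> \<beta> Gamma_int_entries_maps[OF Gi y]
      unfolding Gamma_hform[symmetric] half_plane_pair_def p_def q_def B_def
      by (simp add: mult.commute[of "\<beta>1 * (a * x1 + c * x2) + \<beta>2 * (b * x1 + d * x2)"])
  qed
  finally have "cmod (p - q) \<le> \<theta> * (cmod p + cmod q)" .
  hence "cmod p * (1 - \<theta>) \<le> (1 + \<theta>) * cmod q"
    using norm_triangle_ineq2[of p q] by (simp add: algebra_simps)
  thus ?thesis using \<theta> unfolding p_def[symmetric] q_def[symmetric] by (simp add: field_simps)
qed

section \<open>Hilbert metric of an interval\<close>

text \<open>
  Concavity of \<open>tanh\<close> on the positive half-line.
\<close>

lemma tanh_scaled_ge:
  fixes \<eta> x :: real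
  assumes "0 \<le> \<eta>" "\<eta> \<le> 1" "0 \<le> x"
  shows "\<eta> * tanh x \<le> tanh (\<eta> * x)"
proof -
  let ?h = "\<lambda>x. tanh (\<eta> * x) - \<eta> * tanh x"
  have "?h 0 \<le> ?h x"
  proof (rule DERIV_nonneg_imp_nondecreasing[OF assms(3)])
    fix y :: real assume y: "0 \<le> y"
    have "\<eta> * y \<le> y" using assms y by (simp add: mult_left_le_one_le)
    hence "(tanh (\<eta> * y))\<^sup>2 \<le> (tanh y)\<^sup>2"
      using assms y by (intro power_mono) simp_all
    hence "0 \<le> (1 - (tanh (\<eta> * y))\<^sup>2) * \<eta> - \<eta> * (1 - (tanh y)\<^sup>2)"
      using assms(1) by (simp add: algebra_simps mult_left_mono)
    moreover have "(?h has_real_derivative (1 - (tanh (\<eta> * y))\<^sup>2) * \<eta> - \<eta> * (1 - (tanh y)\<^sup>2)) (at y)"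
      by (auto intro!: derivative_eq_intros)
    ultimately show "\<exists>D. (?h has_real_derivative D) (at y) \<and> 0 \<le> D" by blast
  qed
  thus ?thesis by simp
qed

lemma tanh_quarter_ln:
  assumes "0 < s" "0 < t"
  shows "tanh (ln (t / s) / 4) = (sqrt t - sqrt s) / (sqrt t + sqrt s)"
proof -
  have "ln (sqrt (sqrt t / sqrt s)) = ln (t / s) / 4"
    using assms by (simp add: ln_sqrt real_sqrt_divide[symmetric])
  moreover have "tanh (ln (sqrt (sqrt t / sqrt s))) = (sqrt t / sqrt s - 1) / (sqrt t / sqrt s + 1)"
    using assms by (subst tanh_ln_real) auto
  moreover have "\<dots> = (sqrt t - sqrt s) / (sqrt t + sqrt s)"
    using assms by (simp add: divide_simps)
  ultimately show ?thesis by metis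
qed

text \<open>
  The one-dimensional core of Birkhoff's contraction theorem. The hypothesis bounds by \<open>\<Delta>\<close> the Hilbert
  distance of \<open>s\<close> and \<open>t\<close> in the interval from \<open>a\<close> to \<open>b\<close>; the conclusion bounds their distance in the positive
  half-line. For a given \<open>t / s\<close> the Hilbert distance is smallest when \<open>s * t = a * b\<close>, and there it is
  determined by \<open>tanh (\<Delta> / 4) = tanh (ln (t / s) / 4) / tanh (ln (b / a) / 4)\<close>. Concavity of \<open>tanh\<close> turns
  the resulting inequality between hyperbolic tangents into one between their arguments.
\<close>

lemma interval_hilbert_contraction:
  fixes a b s t :: real
  assumes ord: "0 < a" "a < s" "s \<le> t" "t < b" and \<Delta>: "0 \<le> \<Delta>"
    and cr: "(t - a) * (b - s) \<le> exp \<Delta> * ((b - t) * (s - a))"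
  shows "ln (t / s) \<le> tanh (\<Delta> / 4) * ln (b / a)"
proof -
  define A B S T where "A = sqrt a" and "B = sqrt b" and "S = sqrt s" and "T = sqrt t"
  note d = A_def B_def S_def T_def
  have pos: "0 < A" "A < S" "S \<le> T" "T < B" using ord unfolding d by auto
  have sq: "a = A\<^sup>2" "b = B\<^sup>2" "s = S\<^sup>2" "t = T\<^sup>2" using ord unfolding d by auto
  define N M where "N = T * B - A * S" and "M = B * S - A * T"
  have "A * T < S * B" using pos by (intro mult_strict_mono) auto
  hence M: "0 < M" unfolding M_def by (simp add: mult.commute)
  define r where "r = exp (\<Delta> / 2)"
  have r: "1 \<le> r" "exp \<Delta> = r\<^sup>2" unfolding r_def using \<Delta> by (auto simp: power2_eq_square simp flip: exp_add)
  \<comment> \<open>\<open>N / M\<close> is the square root of the cross-ratio at the symmetric position. Moving there adds the same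
    square to its numerator and denominator, which preserves the bound \<open>r\<^sup>2 \<ge> 1\<close>.\<close>
  have "N\<^sup>2 = (t - a) * (b - s) + (A * B - S * T)\<^sup>2"
    unfolding N_def sq by (simp add: algebra_simps power2_eq_square)
  also have "\<dots> \<le> r\<^sup>2 * ((b - t) * (s - a)) + r\<^sup>2 * (A * B - S * T)\<^sup>2"
    using cr r mult_right_mono[of 1 "r\<^sup>2" "(A * B - S * T)\<^sup>2"] one_le_power[OF r(1), of 2]
    by (intro add_mono) simp_all
  also have "\<dots> = (r * M)\<^sup>2"
    unfolding M_def sq by (simp add: algebra_simps power2_eq_square)
  finally have NM: "N \<le> r * M" by (rule power2_le_imp_le) (use r M in auto)
  define \<eta> where "\<eta> = tanh (\<Delta> / 4)"
  have \<eta>: "0 \<le> \<eta>" "\<eta> \<le> 1" unfolding \<eta>_def using \<Delta> tanh_real_lt_1[of "\<Delta> / 4"] by auto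
  have "tanh (\<Delta> / 4) = tanh (ln (sqrt r))"
    unfolding r_def by (simp add: ln_sqrt)
  also have "\<dots> = (r - 1) / (r + 1)"
    using r by (subst tanh_ln_real) auto
  finally have "\<eta> * (r + 1) = r - 1" using r unfolding \<eta>_def by simp
  hence "\<eta> * (r + 1) * (N + M) = (r - 1) * (N + M)" by simp
  also have "\<dots> \<ge> (r + 1) * (N - M)" using NM by (simp add: algebra_simps)
  finally have "(r + 1) * (N - M) \<le> (r + 1) * (\<eta> * (N + M))" by (simp add: mult_ac)
  hence "N - M \<le> \<eta> * (N + M)" using r by (simp add: mult_le_cancel_left)
  moreover have "N - M = (T - S) * (B + A)" "N + M = (T + S) * (B - A)"
    unfolding N_def M_def by (simp_all add: algebra_simps)
  ultimately have "(T - S) * (B + A) \<le> \<eta> * ((T + S) * (B - A))" by simp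
  hence "(T - S) / (T + S) \<le> \<eta> * ((B - A) / (B + A))"
    using pos by (simp add: field_simps)
  hence "tanh (ln (t / s) / 4) \<le> \<eta> * tanh (ln (b / a) / 4)"
    using ord tanh_quarter_ln[of s t] tanh_quarter_ln[of a b] unfolding d by simp
  also have "\<dots> \<le> tanh (\<eta> * (ln (b / a) / 4))"
    using \<eta> ord by (intro tanh_scaled_ge) auto
  finally show ?thesis unfolding \<eta>_def by simp
qed

text \<open>
  The points may be ends of the interval, where the cross-ratio degenerates; therefore the hypothesis
  refers to all slightly larger intervals.
\<close>

lemma interval_hilbert_contraction_closed:
  fixes a b s t :: real
  assumes ord: "0 < a" "a \<le> s" "s \<le> t" "t \<le> b" and \<Delta>: "0 \<le> \<Delta>"
    and cr: "\<And>c. 1 < c \<Longrightarrow> (t - a / c) * (b * c - s) \<le> exp \<Delta> * ((b * c - t) * (s - a / c))"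
  shows "ln (t / s) \<le> tanh (\<Delta> / 4) * ln (b / a)"
proof (rule field_le_epsilon)
  fix e :: real assume e: "0 < e"
  define \<eta> where "\<eta> = tanh (\<Delta> / 4)"
  have \<eta>: "0 \<le> \<eta>" "\<eta> \<le> 1" unfolding \<eta>_def using \<Delta> tanh_real_lt_1[of "\<Delta> / 4"] by auto
  define c where "c = exp (e / 2)"
  have c: "1 < c" unfolding c_def using e by simp
  have "a / c < a" "b < b * c" using ord c by (simp_all add: field_simps)
  hence "0 < a / c" "a / c < s" "t < b * c" using ord c by (simp, linarith, linarith)
  hence "ln (t / s) \<le> \<eta> * ln (b * c / (a / c))"
    unfolding \<eta>_def by (intro interval_hilbert_contraction ord(3) \<Delta> cr[OF c])
  also have "ln (b * c / (a / c)) = ln (b / a) + e"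
    using ord c unfolding c_def by (simp add: ln_div ln_mult)
  also have "\<eta> * (ln (b / a) + e) \<le> \<eta> * ln (b / a) + e"
    using \<eta> e by (simp add: distrib_left mult_left_le_one_le)
  finally show "ln (t / s) \<le> tanh (\<Delta> / 4) * ln (b / a) + e" unfolding \<eta>_def .
qed

section \<open>Separation from real cones\<close>

definition sublinear :: "('a::real_vector \<Rightarrow> real) \<Rightarrow> bool" where
  "sublinear p \<longleftrightarrow> (\<forall>x y. p (x + y) \<le> p x + p y) \<and> (\<forall>t\<ge>0. \<forall>x. p (t *\<^sub>R x) \<le> t * p x)"

lemma sublinear_add: "sublinear p \<Longrightarrow> p (x + y) \<le> p x + p y"
  and sublinear_scale_le: "sublinear p \<Longrightarrow> 0 \<le> t \<Longrightarrow> p (t *\<^sub>R x) \<le> t * p x"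
  unfolding sublinear_def by auto

lemma sublinear_zero: "sublinear p \<Longrightarrow> p 0 = 0"
  using sublinear_add[of p 0 0] sublinear_scale_le[of p 0 0] by simp

lemma sublinear_ge_neg: "sublinear p \<Longrightarrow> - p (- x) \<le> p x"
  using sublinear_add[of p x "- x"] sublinear_zero[of p] by simp

lemma sublinear_scale:
  assumes p: "sublinear p" and t: "0 \<le> t"
  shows "p (t *\<^sub>R x) = t * p x"
proof (cases "t = 0")
  case False
  hence "p x \<le> inverse t * p (t *\<^sub>R x)"
    using sublinear_scale_le[OF p, of "inverse t" "t *\<^sub>R x"] t by simp
  hence "t * p x \<le> p (t *\<^sub>R x)" using False t by (simp add: field_simps)
  thus ?thesis using sublinear_scale_le[OF p t, of x] by simp
qed (use sublinear_zero[OF p] in simp)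

text \<open>
  The largest sublinear functional below \<open>q\<close> that takes the value \<open>- q y\<close> at \<open>- y\<close>.
\<close>

definition directional_infimum :: "('a::real_vector \<Rightarrow> real) \<Rightarrow> 'a \<Rightarrow> 'a \<Rightarrow> real" where
  "directional_infimum q y x = (INF t\<in>{0..}. q (x + t *\<^sub>R y) - t * q y)"

lemma directional_infimum_le:
  assumes "sublinear q" "0 \<le> t"
  shows "directional_infimum q y x \<le> q (x + t *\<^sub>R y) - t * q y"
  unfolding directional_infimum_def
proof (rule cINF_lower)
  show "bdd_below ((\<lambda>t. q (x + t *\<^sub>R y) - t * q y) ` {0..})"
  proof (rule bdd_belowI2)
    fix s :: real assume "s \<in> {0..}"
    hence "s * q y \<le> q (x + s *\<^sub>R y) + q (- x)"
      using sublinear_add[OF assms(1), of "x + s *\<^sub>R y" "- x"] sublinear_scale[OF assms(1), of s y]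
      by simp
    thus "- q (- x) \<le> q (x + s *\<^sub>R y) - s * q y" by simp
  qed
qed (use assms in simp)

lemma directional_infimum_greatest:
  assumes "\<And>t. 0 \<le> t \<Longrightarrow> c \<le> q (x + t *\<^sub>R y) - t * q y"
  shows "c \<le> directional_infimum q y x"
  unfolding directional_infimum_def by (rule cINF_greatest) (use assms in auto)

lemma sublinear_directional_infimum:
  assumes q: "sublinear q"
  shows "sublinear (directional_infimum q y)"
  unfolding sublinear_def
proof (intro conjI allI impI)
  let ?d = "directional_infimum q y"
  fix x x'
  have "?d (x + x') - ?d x \<le> ?d x'"
  proof (rule directional_infimum_greatest)
    fix t' :: real assume t': "0 \<le> t'"
    have "?d (x + x') - (q (x' + t' *\<^sub>R y) - t' * q y) \<le> ?d x"
    proof (rule directional_infimum_greatest)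
      fix t :: real assume t: "0 \<le> t"
      have "?d (x + x') \<le> q (x + x' + (t + t') *\<^sub>R y) - (t + t') * q y"
        using t t' by (intro directional_infimum_le[OF q]) simp
      also have "x + x' + (t + t') *\<^sub>R y = (x + t *\<^sub>R y) + (x' + t' *\<^sub>R y)"
        by (simp add: algebra_simps)
      also have "q \<dots> \<le> q (x + t *\<^sub>R y) + q (x' + t' *\<^sub>R y)" by (rule sublinear_add[OF q])
      finally show "?d (x + x') - (q (x' + t' *\<^sub>R y) - t' * q y) \<le> q (x + t *\<^sub>R y) - t * q y"
        by (simp add: algebra_simps)
    qed
    thus "?d (x + x') - ?d x \<le> q (x' + t' *\<^sub>R y) - t' * q y" by simp
  qed
  thus "?d (x + x') \<le> ?d x + ?d x'" by simp
next
  let ?d = "directional_infimum q y"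
  fix c :: real and x assume c: "0 \<le> c"
  show "?d (c *\<^sub>R x) \<le> c * ?d x"
  proof (cases "c = 0")
    case True
    thus ?thesis using directional_infimum_le[OF q, of 0 y 0] sublinear_zero[OF q] by simp
  next
    case False
    have "?d (c *\<^sub>R x) / c \<le> ?d x"
    proof (rule directional_infimum_greatest)
      fix t :: real assume t: "0 \<le> t"
      have "?d (c *\<^sub>R x) \<le> q (c *\<^sub>R x + (c * t) *\<^sub>R y) - (c * t) * q y"
        using c t by (intro directional_infimum_le[OF q]) simp
      also have "c *\<^sub>R x + (c * t) *\<^sub>R y = c *\<^sub>R (x + t *\<^sub>R y)" by (simp add: algebra_simps)
      also have "q \<dots> = c * q (x + t *\<^sub>R y)" by (rule sublinear_scale[OF q c])
      finally show "?d (c *\<^sub>R x) / c \<le> q (x + t *\<^sub>R y) - t * q y"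
        using c False by (simp add: field_simps)
    qed
    thus ?thesis using c False by (simp add: field_simps)
  qed
qed

text \<open>
  Zorn's lemma applies because a chain of sublinear functionals below \<open>p\<close> is bounded below at \<open>x\<close> by
  \<open>- p (- x)\<close>, and its pointwise infimum is again sublinear.
\<close>

lemma minimal_sublinear_exists:
  fixes p :: "'a::real_vector \<Rightarrow> real"
  assumes p: "sublinear p"
  shows "\<exists>q. sublinear q \<and> q \<le> p \<and> (\<forall>q'. sublinear q' \<and> q' \<le> q \<longrightarrow> q' = q)"
proof -
  let ?A = "{q. sublinear q \<and> q \<le> p}"
  let ?P = "\<lambda>q q'. q' \<le> q"
  have "\<exists>m\<in>?A. \<forall>q\<in>?A. ?P m q \<longrightarrow> q = m"
  proof (rule predicate_Zorn)
    show "partial_order_on ?A (relation_of ?P ?A)"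
      by (rule partial_order_on_relation_ofI) auto
    fix C assume "C \<in> Chains (relation_of ?P ?A)"
    hence CA: "C \<subseteq> ?A" and chain: "\<And>q q'. q \<in> C \<Longrightarrow> q' \<in> C \<Longrightarrow> q \<le> q' \<or> q' \<le> q"
      unfolding Chains_def relation_of_def by auto
    show "\<exists>u\<in>?A. \<forall>q\<in>C. u \<le> q"
    proof (cases "C = {}")
      case True
      thus ?thesis using p by auto
    next
      case False
      define u where "u x = (INF q\<in>C. q x)" for x
      have bdd: "bdd_below ((\<lambda>q. q x) ` C)" for x
      proof (rule bdd_belowI2)
        fix q assume "q \<in> C"
        hence "sublinear q" "q (- x) \<le> p (- x)" using CA by (auto simp: le_fun_def)
        thus "- p (- x) \<le> q x" using sublinear_ge_neg[of q x] by simp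
      qed
      have ule: "u x \<le> q x" if "q \<in> C" for q x
        unfolding u_def by (rule cINF_lower[OF bdd that])
      have ug: "c \<le> u x" if "\<And>q. q \<in> C \<Longrightarrow> c \<le> q x" for c x
        unfolding u_def by (rule cINF_greatest) (use that False in auto)
      have "sublinear u"
        unfolding sublinear_def
      proof (intro conjI allI impI)
        fix x y
        have "u (x + y) - u x \<le> u y"
        proof (rule ug)
          fix q assume q: "q \<in> C"
          have "u (x + y) - q y \<le> u x"
          proof (rule ug)
            fix q' assume q': "q' \<in> C"
            \<comment> \<open>Subadditivity of the infimum is where the chain property enters: one functional lies below both.\<close>
            obtain r where r: "r \<in> C" "r \<le> q" "r \<le> q'" using chain[OF q q'] q q' by auto
            have "u (x + y) \<le> r (x + y)" by (rule ule[OF r(1)])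
            also have "\<dots> \<le> r x + r y" using r(1) CA by (auto intro: sublinear_add)
            also have "\<dots> \<le> q' x + q y" using r by (auto simp: le_fun_def intro: add_mono)
            finally show "u (x + y) - q y \<le> q' x" by simp
          qed
          thus "u (x + y) - u x \<le> q y" by simp
        qed
        thus "u (x + y) \<le> u x + u y" by simp
      next
        fix t :: real and x assume t: "0 \<le> t"
        show "u (t *\<^sub>R x) \<le> t * u x"
        proof (cases "t = 0")
          case True
          obtain q where q: "q \<in> C" using False by auto
          have "u 0 \<le> q 0" by (rule ule[OF q])
          also have "\<dots> = 0" using q CA sublinear_zero by auto
          finally show ?thesis using True by simp
        next
          case F: False
          have "u (t *\<^sub>R x) / t \<le> u x"
          proof (rule ug)
            fix q assume q: "q \<in> C"
            have "u (t *\<^sub>R x) \<le> q (t *\<^sub>R x)" by (rule ule[OF q])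
            also have "\<dots> \<le> t * q x" using q CA t by (auto intro: sublinear_scale_le)
            finally show "u (t *\<^sub>R x) / t \<le> q x" using t F by (simp add: field_simps)
          qed
          thus ?thesis using t F by (simp add: field_simps)
        qed
      qed
      moreover have "u \<le> p"
      proof -
        obtain q where q: "q \<in> C" using False by auto
        thus ?thesis using ule[OF q] CA by (auto simp: le_fun_def intro: order_trans)
      qed
      ultimately show ?thesis using ule by (auto simp: le_fun_def)
    qed
  qed
  thus ?thesis by (metis (no_types, lifting) mem_Collect_eq order_trans)
qed

text \<open>
  By minimality \<open>directional_infimum q y = q\<close>, so \<open>q x \<le> q (x + y) - q y\<close>; with subadditivity, \<open>q\<close> is additive.
\<close>

lemma minimal_sublinear_linear:
  assumes q: "sublinear q" and min: "\<And>q'. sublinear q' \<Longrightarrow> q' \<le> q \<Longrightarrow> q' = q"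
  shows "linear q"
proof -
  have eq: "directional_infimum q y = q" for y
  proof (rule min[OF sublinear_directional_infimum[OF q]])
    show "directional_infimum q y \<le> q"
      using directional_infimum_le[OF q, of 0 y] by (auto simp: le_fun_def)
  qed
  have add: "q (x + y) = q x + q y" for x y
    using directional_infimum_le[OF q, of 1 y x] sublinear_add[OF q, of x y] by (simp add: eq)
  hence neg: "q (- x) = - q x" for x
    using add[of x "- x"] sublinear_zero[OF q] by simp
  show ?thesis
  proof (rule linearI)
    show "q (t *\<^sub>R x) = t *\<^sub>R q x" for t x
    proof (cases "0 \<le> t")
      case False
      thus ?thesis using sublinear_scale[OF q, of "- t" x] neg[of "t *\<^sub>R x"] by simp
    qed (simp add: sublinear_scale[OF q])
  qed (rule add)
qed

text \<open>
  A minimal sublinear functional below \<open>p\<close> need not agree with \<open>p\<close> at \<open>x0\<close>; one below the directional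
  infimum of \<open>p\<close> along \<open>x0\<close> does.
\<close>

theorem hahn_banach_sublinear:
  assumes p: "sublinear p"
  shows "\<exists>l. linear l \<and> (\<forall>x. l x \<le> p x) \<and> l x0 = p x0"
proof -
  let ?d = "directional_infimum p x0"
  obtain l where l: "sublinear l" "l \<le> ?d" and min: "\<And>q'. sublinear q' \<Longrightarrow> q' \<le> l \<Longrightarrow> q' = l"
    using minimal_sublinear_exists[OF sublinear_directional_infimum[OF p]] by blast
  have lin: "linear l" by (rule minimal_sublinear_linear[OF l(1) min])
  have lp: "l x \<le> p x" for x
    using l(2) directional_infimum_le[OF p, of 0 x0 x] by (auto simp: le_fun_def intro: order_trans)
  have "l (- x0) \<le> - p x0"
    using l(2) directional_infimum_le[OF p, of 1 x0 "- x0"] sublinear_zero[OF p]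
    by (auto simp: le_fun_def intro: order_trans)
  hence "p x0 \<le> l x0" using linear_neg[OF lin, of x0] by simp
  with lp[of x0] have "l x0 = p x0" by simp
  with lin lp show ?thesis by blast
qed

lemma real_cone_closed: "real_cone K \<Longrightarrow> closed K"
  unfolding real_cone_def by blast

lemma real_cone_add: "real_cone K \<Longrightarrow> x \<in> K \<Longrightarrow> y \<in> K \<Longrightarrow> x + y \<in> K"
  unfolding real_cone_def by blast

lemma real_cone_scale: "real_cone K \<Longrightarrow> 0 \<le> t \<Longrightarrow> x \<in> K \<Longrightarrow> t *\<^sub>R x \<in> K"
  unfolding real_cone_def by blast

lemma real_cone_zero: "real_cone K \<Longrightarrow> 0 \<in> K"
  unfolding real_cone_def by blast

lemma real_cone_antisym:
  assumes "real_cone K" "x \<in> K" "- x \<in> K"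
  shows "x = 0"
proof -
  have "x \<in> uminus ` K" using assms(3) by (metis image_eqI minus_minus)
  thus ?thesis using assms unfolding real_cone_def by blast
qed

text \<open>
  Apply the Hahn-Banach theorem to the distance of \<open>- x\<close> from the cone. This sublinear functional is bounded by the
  norm, vanishes on \<open>- K\<close>, and is positive at \<open>- y\<close> because \<open>K\<close> is closed.
\<close>

lemma cone_separation:
  fixes K :: "'r::banach set"
  assumes K: "real_cone K" and y: "y \<notin> K"
  shows "\<exists>l\<in>dual_cone K. blinfun_apply l y < 0"
proof -
  define p where "p x = infdist (- x) K" for x
  have ne: "K \<noteq> {}" using real_cone_zero[OF K] by auto
  have ple: "p x \<le> norm (x + k)" if "k \<in> K" for x k
    using infdist_le[OF that, of "- x"] unfolding p_def by (simp add: dist_norm norm_minus_commute add.commute)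
  have pg: "c \<le> p x" if "\<And>k. k \<in> K \<Longrightarrow> c \<le> norm (x + k)" for c x
    unfolding p_def infdist_notempty[OF ne]
  proof (rule cINF_greatest[OF ne])
    fix k assume "k \<in> K"
    moreover have "dist (- x) k = norm (x + k)"
      by (metis dist_norm minus_add_distrib norm_minus_cancel uminus_add_conv_diff add.commute)
    ultimately show "c \<le> dist (- x) k" using that by simp
  qed
  have p: "sublinear p"
    unfolding sublinear_def
  proof (intro conjI allI impI)
    fix x x'
    have "p (x + x') - p x \<le> p x'"
    proof (rule pg)
      fix k' assume k': "k' \<in> K"
      have "p (x + x') - norm (x' + k') \<le> p x"
      proof (rule pg)
        fix k assume k: "k \<in> K"
        have "p (x + x') \<le> norm ((x + x') + (k + k'))"
          by (rule ple[OF real_cone_add[OF K k k']])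
        also have "\<dots> \<le> norm (x + k) + norm (x' + k')"
          using norm_triangle_ineq[of "x + k" "x' + k'"] by (simp add: algebra_simps)
        finally show "p (x + x') - norm (x' + k') \<le> norm (x + k)" by simp
      qed
      thus "p (x + x') - p x \<le> norm (x' + k')" by simp
    qed
    thus "p (x + x') \<le> p x + p x'" by simp
  next
    fix t :: real and x assume t: "0 \<le> t"
    show "p (t *\<^sub>R x) \<le> t * p x"
    proof (cases "t = 0")
      case True
      thus ?thesis using ple[OF real_cone_zero[OF K], of 0] by simp
    next
      case False
      have "p (t *\<^sub>R x) / t \<le> p x"
      proof (rule pg)
        fix k assume k: "k \<in> K"
        have "p (t *\<^sub>R x) \<le> norm (t *\<^sub>R x + t *\<^sub>R k)"
          by (rule ple[OF real_cone_scale[OF K t k]])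
        also have "\<dots> = t * norm (x + k)" using t by (simp flip: scaleR_add_right)
        finally show "p (t *\<^sub>R x) / t \<le> norm (x + k)" using t False by (simp add: field_simps)
      qed
      thus ?thesis using t False by (simp add: field_simps)
    qed
  qed
  have pos: "0 < p (- y)"
    unfolding p_def using in_closed_iff_infdist_zero[OF real_cone_closed[OF K] ne] y infdist_nonneg[of y K]
    by (simp add: order_less_le)
  obtain l where lin: "linear l" and lp: "\<And>x. l x \<le> p x" and l0: "l (- y) = p (- y)"
    using hahn_banach_sublinear[OF p] by metis
  have pn: "p x \<le> norm x" for x using ple[OF real_cone_zero[OF K], of x] by simp
  have "norm (l x) \<le> norm x * 1" for x
    using order_trans[OF lp[of x] pn] order_trans[OF lp[of "- x"] pn] linear_neg[OF lin, of x]
    by (simp add: abs_le_iff)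
  hence bl: "bounded_linear l"
    using lin by (intro bounded_linear_intro[where K=1]) (auto simp: linear_add linear_scale)
  have "0 \<le> l k" if "k \<in> K" for k
    using lp[of "- k"] ple[OF that, of "- k"] linear_neg[OF lin, of k] by simp
  moreover have "l y < 0" using pos l0 linear_neg[OF lin, of y] by simp
  ultimately show ?thesis
    using bl by (intro bexI[of _ "Blinfun l"]) (auto simp: dual_cone_def bounded_linear_Blinfun_apply)
qed

section \<open>Bounded inverses\<close>

text \<open>
  By Baire's theorem the closure of the image of some ball has interior points, hence every \<open>z\<close> has an
  approximate preimage of controlled norm with an error of at most half the norm of \<open>z\<close>. Correcting the error repeatedly
  gives a geometric series of preimages.
\<close>

theorem bounded_inverse_banach:
  fixes T :: "'a::banach \<Rightarrow> 'b::banach"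
  assumes T: "bounded_linear T" and bij: "bij T"
  shows "\<exists>C. \<forall>x. norm x \<le> C * norm (T x)"
proof -
  interpret T: bounded_linear T by (rule T)
  define F where "F n = closure (T ` cball 0 (real n))" for n :: nat
  have symF: "z - w \<in> closure (T ` cball 0 (2 * real n))" if zw: "z \<in> F n" "w \<in> F n" for z w n
  proof (rule closure_approachable[THEN iffD2], intro allI impI)
    fix e :: real assume e: "0 < e"
    obtain x where x: "x \<in> cball 0 (real n)" "dist (T x) z < e / 2"
      using zw(1) e unfolding F_def closure_approachable by (metis half_gt_zero imageE)
    obtain y where y: "y \<in> cball 0 (real n)" "dist (T y) w < e / 2"
      using zw(2) e unfolding F_def closure_approachable by (metis half_gt_zero imageE)
    have "dist (T (x - y)) (z - w) \<le> dist (T x) z + dist (T y) w"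
      unfolding dist_norm T.diff
      using norm_triangle_ineq4[of "T x - z" "T y - w"] by (simp add: algebra_simps)
    moreover have "x - y \<in> cball 0 (2 * real n)"
      using x(1) y(1) norm_triangle_ineq4[of x y] by simp
    ultimately show "\<exists>v\<in>T ` cball 0 (2 * real n). dist v (z - w) < e"
      using x y by (intro bexI[of _ "T (x - y)"]) auto
  qed
  have cover: "(\<Union>n. F n) = UNIV"
  proof (intro set_eqI iffI UNIV_I)
    fix z
    obtain x where x: "z = T x" using bij by (meson bij_pointE)
    obtain n where "norm x \<le> real n" using real_arch_simple by blast
    hence "z \<in> F n" unfolding F_def x by (intro subsetD[OF closure_subset] imageI) simp
    thus "z \<in> (\<Union>n. F n)" by blast
  qed
  have "\<exists>n. interior (F n) \<noteq> {}"
  proof (rule ccontr)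
    assume "\<not> ?thesis"
    hence "(euclidean interior_of \<Union>(range F)) = {}"
      by (intro Baire_category_alt disjI1 completely_metrizable_space_euclidean)
         (auto simp: F_def euclidean_interior_of)
    thus False using cover by simp
  qed
  then obtain n y r where r: "0 < r" "ball y r \<subseteq> F n"
    by (metis all_not_in_conv mem_interior)
  define M where "M = 4 * real n / r"
  have approx: "\<exists>x. norm x \<le> M * norm z \<and> norm (z - T x) \<le> norm z / 2" for z
  proof (cases "z = 0")
    case False
    \<comment> \<open>The scaled vector \<open>c z\<close> has norm \<open>r / 2\<close>, so \<open>y + c z\<close> and \<open>y\<close> lie in the ball, and their difference is
      approximated by images of vectors of norm at most \<open>2 n\<close>.\<close>
    define c where "c = r / (2 * norm z)"
    have c: "0 < c" unfolding c_def using r False by simp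
    have "norm (c *\<^sub>R z) < r" unfolding c_def using r False by simp
    hence "y + c *\<^sub>R z \<in> F n" "y \<in> F n" using r by (auto simp: dist_norm)
    from symF[OF this] have "c *\<^sub>R z \<in> closure (T ` cball 0 (2 * real n))" by simp
    moreover have "0 < c * (norm z / 2)" using c False by simp
    ultimately obtain x where x: "norm x \<le> 2 * real n" "norm (T x - c *\<^sub>R z) < c * (norm z / 2)"
      unfolding closure_approachable dist_norm by (metis imageE mem_cball_0)
    have "z - T (x /\<^sub>R c) = - ((T x - c *\<^sub>R z) /\<^sub>R c)"
      using c by (simp add: T.scaleR scaleR_diff_right)
    hence "norm (z - T (x /\<^sub>R c)) = norm (T x - c *\<^sub>R z) / c"
      using c by (simp add: divide_inverse mult.commute)
    also have "\<dots> \<le> norm z / 2" using x(2) c by (simp add: field_simps)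
    finally have 1: "norm (z - T (x /\<^sub>R c)) \<le> norm z / 2" .
    have "norm (x /\<^sub>R c) = norm x / c" using c by (simp add: divide_inverse mult.commute)
    also have "\<dots> \<le> 2 * real n / c" using x(1) c by (simp add: divide_right_mono)
    also have "\<dots> = M * norm z" unfolding M_def c_def using r False by (simp add: field_simps)
    finally show ?thesis using 1 by blast
  qed (intro exI[of _ 0], simp add: T.zero)
  then obtain g where g: "\<And>z. norm (g z) \<le> M * norm z" "\<And>z. norm (z - T (g z)) \<le> norm z / 2"
    by metis
  have M: "0 \<le> M" unfolding M_def using r by simp
  have bound: "norm x \<le> (2 * M) * norm (T x)" for x
  proof -
    define z where "z = rec_nat (T x) (\<lambda>_ w. w - T (g w))"
    have z0: "z 0 = T x" and zS: "z (Suc k) = z k - T (g (z k))" for k unfolding z_def by simp_all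
    have zn: "norm (z k) \<le> norm (T x) * (1 / 2) ^ k" for k
    proof (induction k)
      case (Suc k)
      show ?case using g(2)[of "z k"] Suc by (simp add: zS)
    qed (simp add: z0)
    have gn: "norm (g (z k)) \<le> M * norm (T x) * (1 / 2) ^ k" for k
      using order_trans[OF g(1) mult_left_mono[OF zn M]] by (simp add: mult.assoc)
    have geo: "(\<lambda>k. M * norm (T x) * (1 / 2) ^ k) sums (M * norm (T x) * 2)"
      using sums_mult[OF geometric_sums[of "1 / 2 :: real"], of "M * norm (T x)"] by simp
    have sg: "summable (\<lambda>k. g (z k))"
      by (rule summable_comparison_test'[OF sums_summable[OF geo], of 0]) (use gn in simp)
    have "(\<lambda>k. T (g (z k))) sums T (\<Sum>k. g (z k))"
      by (rule T.sums[OF summable_sums[OF sg]])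
    moreover have "(\<lambda>k. T (g (z k))) sums (z 0 - 0)"
    proof -
      have "z \<longlonglongrightarrow> 0"
      proof (rule Lim_null_comparison)
        show "\<forall>\<^sub>F k in sequentially. norm (z k) \<le> norm (T x) * (1 / 2) ^ k" using zn by simp
        show "(\<lambda>k. norm (T x) * (1 / 2) ^ k) \<longlonglongrightarrow> 0"
          by (intro tendsto_mult_right_zero LIMSEQ_power_zero) simp
      qed
      from telescope_sums'[OF this] show ?thesis by (simp add: zS)
    qed
    ultimately have "T (\<Sum>k. g (z k)) = T x" using sums_unique2 z0 by fastforce
    hence x: "x = (\<Sum>k. g (z k))" using bij by (metis bij_def injD)
    have "norm (\<Sum>k. g (z k)) \<le> M * norm (T x) * 2"
      using summable_norm_comparison_test sums_le[OF _ summable_sums geo] norm_suminf_le[OF gn sums_summable[OF geo]]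
      by (simp add: sums_unique[OF geo, symmetric])
    thus ?thesis using x by (simp add: mult_ac)
  qed
  thus ?thesis by blast
qed

section \<open>Complexified Banach spaces\<close>

lemma scaleC_minus_left: "(- c) *\<^sub>C x = - (c *\<^sub>C x)" for x :: "'a::complex_banach"
proof -
  have "c *\<^sub>C x + (- c) *\<^sub>C x = 0 *\<^sub>C x" by (metis scaleC_add_left add.right_inverse)
  also have "\<dots> = 0" using scaleC_of_real[of 0 x] by simp
  finally show ?thesis by (simp add: eq_neg_iff_add_eq_0 add.commute)
qed

lemma scaleC_zero_right [simp]: "c *\<^sub>C (0 :: 'a::complex_banach) = 0"
  using norm_scaleC[of c 0] by simp

lemma scaleC_one [simp]: "1 *\<^sub>C x = x" for x :: "'a::complex_banach"
  using scaleC_of_real[of 1 x] by simp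

lemma scaleC_zero_left [simp]: "0 *\<^sub>C x = 0" for x :: "'a::complex_banach"
  using scaleC_of_real[of 0 x] by simp

lemma scaleC_scaleR: "c *\<^sub>C (r *\<^sub>R x) = r *\<^sub>R (c *\<^sub>C x)" for x :: "'a::complex_banach"
  by (metis scaleC_of_real scaleC_scaleC mult.commute)

lemma scaleC_eq_0_iff [simp]: "c *\<^sub>C x = 0 \<longleftrightarrow> c = 0 \<or> x = 0" for x :: "'a::complex_banach"
  by (metis norm_scaleC mult_eq_0_iff norm_eq_zero)

lemma bounded_linear_scaleC: "bounded_linear (\<lambda>x :: 'a::complex_banach. c *\<^sub>C x)"
  by (rule bounded_linear_intro[of _ "cmod c"])
     (simp_all add: scaleC_add_right scaleC_scaleR norm_scaleC mult.commute)

lemma bounded_clinear_add: "bounded_clinear f \<Longrightarrow> f (x + y) = f x + f y"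
  and bounded_clinear_diff: "bounded_clinear f \<Longrightarrow> f (x - y) = f x - f y"
  and bounded_clinear_scaleR: "bounded_clinear f \<Longrightarrow> f (r *\<^sub>R x) = r *\<^sub>R f x"
  and bounded_clinear_scaleC: "bounded_clinear f \<Longrightarrow> f (c *\<^sub>C x) = c *\<^sub>C f x"
  and bounded_clinear_zero: "bounded_clinear f \<Longrightarrow> f 0 = 0"
  unfolding bounded_clinear_def
  by (auto simp: bounded_linear.linear linear_add linear_diff linear_scale linear_0)

lemma bounded_clinear_compose:
  "bounded_clinear f \<Longrightarrow> bounded_clinear g \<Longrightarrow> bounded_clinear (\<lambda>x. f (g x))"
  unfolding bounded_clinear_def by (simp add: bounded_linear_compose)

lemma bounded_clinear_lincomb:
  fixes f g :: "'a::complex_banach \<Rightarrow> complex"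
  assumes "bounded_clinear f" "bounded_clinear g"
  shows "bounded_clinear (\<lambda>x. c * f x + d * g x)"
  using assms unfolding bounded_clinear_def scaleC_complex_def
  by (auto intro!: bounded_linear_add bounded_linear_mult_right[THEN bounded_linear_compose] simp: algebra_simps)

locale complexified =
  fixes \<iota> :: "'r::banach \<Rightarrow> 'c::complex_banach"
  assumes complexification: "complexification \<iota>"
begin

lemma linear_emb: "linear \<iota>" and norm_emb: "norm (\<iota> u) = norm u"
  using complexification unfolding complexification_def by auto

lemma bounded_linear_emb: "bounded_linear \<iota>"
  using linear_emb by (intro bounded_linear_intro[where K=1]) (auto simp: linear_add linear_scale norm_emb)

definition join :: "'r \<times> 'r \<Rightarrow> 'c" where
  "join p = \<iota> (fst p) + \<i> *\<^sub>C \<iota> (snd p)"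

lemma bij_join: "bij join"
proof -
  have "\<exists>!p. x = join p" for x
    using complexification unfolding complexification_def join_def by blast
  thus ?thesis unfolding bij_iff by metis
qed

lemma bounded_linear_join: "bounded_linear join"
  unfolding join_def
  by (intro bounded_linear_add bounded_linear_compose[OF bounded_linear_emb]
      bounded_linear_compose[OF bounded_linear_scaleC] bounded_linear_fst bounded_linear_snd)

definition re_part :: "'c \<Rightarrow> 'r" where "re_part x = fst (inv join x)"
definition im_part :: "'c \<Rightarrow> 'r" where "im_part x = snd (inv join x)"

lemma decompose: "x = \<iota> (re_part x) + \<i> *\<^sub>C \<iota> (im_part x)"
  using bij_join[THEN bij_is_surj, THEN surj_f_inv_f, of x] unfolding join_def re_part_def im_part_def by simp

lemma parts_join: "re_part (\<iota> u + \<i> *\<^sub>C \<iota> v) = u" "im_part (\<iota> u + \<i> *\<^sub>C \<iota> v) = v"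
  using inv_f_f[OF bij_join[THEN bij_is_inj], of "(u, v)"] unfolding join_def re_part_def im_part_def by simp_all

text \<open>
  The norm of the complexification is only assumed to restrict to the norm of the real space. That the
  projections are bounded nevertheless, so that extended real functionals are
  continuous, is the bounded inverse theorem for \<open>join\<close>.
\<close>

lemma bounded_linear_parts: "bounded_linear re_part" "bounded_linear im_part"
proof -
  obtain C where C: "\<And>p. norm p \<le> C * norm (join p)"
    using bounded_inverse_banach[OF bounded_linear_join bij_join] by blast
  interpret J: bounded_linear join by (rule bounded_linear_join)
  note inv = bij_join[THEN bij_is_surj, THEN surj_f_inv_f] bij_join[THEN bij_is_inj, THEN inv_f_f]
  have "bounded_linear (inv join)"
  proof (rule bounded_linear_intro)
    show "inv join (x + y) = inv join x + inv join y" for x y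
      by (metis J.add inv)
    show "inv join (r *\<^sub>R x) = r *\<^sub>R inv join x" for r x
      by (metis J.scaleR inv)
    show "norm (inv join x) \<le> norm x * C" for x
      using C[of "inv join x"] by (simp add: inv(1) mult.commute)
  qed
  thus "bounded_linear re_part" "bounded_linear im_part"
    unfolding re_part_def im_part_def
    by (auto intro: bounded_linear_compose[OF bounded_linear_fst] bounded_linear_compose[OF bounded_linear_snd])
qed

lemma pairing_eq:
  "pairing \<iota> l x = of_real (blinfun_apply l (re_part x)) + \<i> * of_real (blinfun_apply l (im_part x))"
  unfolding pairing_def
proof (rule the_equality)
  show "\<exists>u v. x = \<iota> u + \<i> *\<^sub>C \<iota> v \<and>
    of_real (blinfun_apply l (re_part x)) + \<i> * of_real (blinfun_apply l (im_part x))
    = complex_of_real (blinfun_apply l u) + \<i> * complex_of_real (blinfun_apply l v)"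
    using decompose[of x] by blast
qed (auto simp: parts_join)

lemma pairing_emb [simp]: "pairing \<iota> l (\<iota> u) = of_real (blinfun_apply l u)"
  using parts_join[of u 0] by (simp add: pairing_eq linear_0[OF linear_emb] blinfun.zero_right)

lemma bounded_clinear_pairing: "bounded_clinear (pairing \<iota> l)"
proof -
  have cr: "pairing \<iota> l (r *\<^sub>R x) = of_real r * pairing \<iota> l x"
    and ad: "pairing \<iota> l (x + y) = pairing \<iota> l x + pairing \<iota> l y" for r x y
    unfolding pairing_eq using bounded_linear_parts[THEN bounded_linear.linear]
    by (simp_all add: linear_add linear_scale blinfun.add_right blinfun.scaleR_right algebra_simps)
  have bl: "bounded_linear (pairing \<iota> l)"
    unfolding pairing_eq
    by (intro bounded_linear_add bounded_linear_mult_right[THEN bounded_linear_compose]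
        bounded_linear_of_real[THEN bounded_linear_compose] blinfun.bounded_linear_right[THEN bounded_linear_compose] bounded_linear_parts)
  have i: "pairing \<iota> l (\<i> *\<^sub>C x) = \<i> * pairing \<iota> l x" for x
  proof -
    have "\<i> *\<^sub>C x = \<iota> (- im_part x) + \<i> *\<^sub>C \<iota> (re_part x)"
      by (subst decompose[of x])
         (simp add: scaleC_add_right scaleC_scaleC scaleC_minus_left linear_neg[OF linear_emb])
    hence "re_part (\<i> *\<^sub>C x) = - im_part x" "im_part (\<i> *\<^sub>C x) = re_part x"
      by (simp_all only: parts_join)
    thus ?thesis
      by (simp add: pairing_eq blinfun.minus_right algebra_simps)
  qed
  have "pairing \<iota> l (c *\<^sub>C x) = c * pairing \<iota> l x" for c x
  proof -
    have "c *\<^sub>C x = Re c *\<^sub>R x + Im c *\<^sub>R (\<i> *\<^sub>C x)"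
      by (subst complex_eq[of c])
         (simp only: scaleC_add_left scaleC_of_real[symmetric] scaleC_scaleC mult.commute)
    hence "pairing \<iota> l (c *\<^sub>C x) = (of_real (Re c) + \<i> * of_real (Im c)) * pairing \<iota> l x"
      by (simp add: ad cr i algebra_simps)
    thus ?thesis by (simp flip: complex_eq)
  qed
  thus ?thesis using bl unfolding bounded_clinear_def scaleC_complex_def by blast
qed

lemma pairing_diff: "pairing \<iota> l (x - y) = pairing \<iota> l x - pairing \<iota> l y"
  and pairing_add: "pairing \<iota> l (x + y) = pairing \<iota> l x + pairing \<iota> l y"
  and pairing_scaleC: "pairing \<iota> l (c *\<^sub>C x) = c * pairing \<iota> l x"
  using bounded_clinear_pairing[of l]
  by (simp_all add: bounded_clinear_add bounded_clinear_diff bounded_clinear_scaleC scaleC_complex_def)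

lemma clinear_eq_extension:
  assumes "bounded_clinear \<nu>"
  shows "\<nu> x = \<nu> (\<iota> (re_part x)) + \<i> * \<nu> (\<iota> (im_part x))"
  by (subst decompose[of x])
     (simp only: bounded_clinear_add[OF assms] bounded_clinear_scaleC[OF assms] scaleC_complex_def)

end

section \<open>Complexified cones\<close>

text \<open>
  The arguments of the nonzero elements differ pairwise by at most \<open>\<pi> / 2\<close>, so after a rotation by the
  infimum of the arguments the set lies in the closed first quadrant. Multiplying first by the
  conjugate of one element keeps all arguments within \<open>\<pi> / 2\<close> of 0, away from the cut of \<open>Arg\<close>.
\<close>

lemma sector_rotation:
  fixes S :: "complex set"
  assumes S: "\<And>z w. z \<in> S \<Longrightarrow> w \<in> S \<Longrightarrow> 0 \<le> Re (z * cnj w)"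
  shows "\<exists>c. c \<noteq> 0 \<and> (\<forall>z\<in>S. 0 \<le> Re (c * z) \<and> 0 \<le> Im (c * z))"
proof (cases "S \<subseteq> {0}")
  case True
  thus ?thesis by (intro exI[of _ 1]) auto
next
  case False
  then obtain s0 where s0: "s0 \<in> S" "s0 \<noteq> 0" by auto
  define S' where "S' = (\<lambda>z. cnj s0 * z) ` S"
  have S'pair: "0 \<le> Re (z * cnj w)" if zw: "z \<in> S'" "w \<in> S'" for z w
  proof -
    obtain z' w' where z': "z = cnj s0 * z'" "z' \<in> S" and w': "w = cnj s0 * w'" "w' \<in> S"
      using zw unfolding S'_def by auto
    have "z * cnj w = (s0 * cnj s0) * (z' * cnj w')" unfolding z' w' by simp
    also have "\<dots> = of_real ((cmod s0)\<^sup>2) * (z' * cnj w')" by (simp only: complex_norm_square)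
    also have "Re \<dots> = (cmod s0)\<^sup>2 * Re (z' * cnj w')" by (simp del: of_real_power)
    finally show ?thesis using S[OF z'(2) w'(2)] by simp
  qed
  have S're: "0 \<le> Re z" if "z \<in> S'" for z
    using S[OF _ s0(1)] that unfolding S'_def by (auto simp: mult.commute)
  define N where "N = S' - {0}"
  have polar: "z = of_real (cmod z) * cis (Arg z)" for z
    using rcis_cmod_Arg[of z] unfolding rcis_def by simp
  have arg: "\<bar>Arg z\<bar> \<le> pi / 2" if "z \<in> N" for z
  proof -
    have "0 \<le> cos (Arg z)" using S're[of z] that unfolding N_def by (auto simp: cos_Arg)
    thus ?thesis
      using Arg_bounded[of z] cos_gt_zero_pi cos_monotone_0_pi[of "pi/2" "\<bar>Arg z\<bar>"]
      by (cases "\<bar>Arg z\<bar> \<le> pi / 2") (auto simp: abs_if split: if_splits)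
  qed
  have argdiff: "Arg z \<le> Arg w + pi / 2" if zw: "z \<in> N" "w \<in> N" for z w
  proof (rule ccontr)
    assume "\<not> ?thesis"
    hence d: "pi / 2 < Arg z - Arg w" "Arg z - Arg w \<le> pi" using arg[OF zw(1)] arg[OF zw(2)] by auto
    have "z * cnj w = of_real (cmod z * cmod w) * cis (Arg z - Arg w)"
      by (subst (1) polar[of z], subst (1) polar[of w]) (simp add: cis_cnj cis_mult cis_inverse diff_conv_add_uminus del: add_uminus_conv_diff)
    hence "Re (z * cnj w) = cmod z * cmod w * cos (Arg z - Arg w)" by simp
    moreover have "cos (Arg z - Arg w) < 0"
      using cos_monotone_0_pi[of "pi/2" "Arg z - Arg w"] d by simp
    ultimately have "Re (z * cnj w) < 0"
      using zw unfolding N_def by (simp add: mult_pos_neg)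
    thus False using S'pair[of z w] zw unfolding N_def by auto
  qed
  have sN: "cnj s0 * s0 \<in> N" unfolding N_def S'_def using s0 by auto
  define \<phi> where "\<phi> = (INF z\<in>N. Arg z)"
  have "- (pi / 2) \<le> Arg z" if "z \<in> N" for z using arg[OF that] by linarith
  hence bdd: "bdd_below (Arg ` N)" by (rule bdd_belowI2)
  have lo: "\<phi> \<le> Arg z" if "z \<in> N" for z unfolding \<phi>_def by (rule cINF_lower[OF bdd that])
  have hi: "Arg z \<le> \<phi> + pi / 2" if z: "z \<in> N" for z
  proof -
    have "Arg z - pi / 2 \<le> \<phi>" unfolding \<phi>_def
      using sN argdiff[OF z] by (intro cINF_greatest) (auto simp: algebra_simps)
    thus ?thesis by simp
  qed
  have quad: "0 \<le> Re (cis (- \<phi>) * z) \<and> 0 \<le> Im (cis (- \<phi>) * z)" if "z \<in> S'" for z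
  proof (cases "z = 0")
    case False
    hence z: "z \<in> N" using that unfolding N_def by simp
    have "cis (- \<phi>) * z = of_real (cmod z) * cis (Arg z - \<phi>)"
      by (subst polar[of z]) (simp add: cis_mult del: of_real_mult)
    moreover have "0 \<le> cos (Arg z - \<phi>)" "0 \<le> sin (Arg z - \<phi>)"
      using lo[OF z] hi[OF z] pi_gt_zero by (auto intro!: cos_ge_zero sin_ge_zero)
    ultimately show ?thesis by simp
  qed simp
  show ?thesis
  proof (intro exI[of _ "cis (- \<phi>) * cnj s0"] conjI ballI)
    fix z assume "z \<in> S"
    hence "cnj s0 * z \<in> S'" unfolding S'_def by blast
    from quad[OF this] show "0 \<le> Re (cis (- \<phi>) * cnj s0 * z)" "0 \<le> Im (cis (- \<phi>) * cnj s0 * z)"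
      by (simp_all only: mult.assoc)
  qed (use s0 in simp)
qed

locale complex_cone = complexified \<iota> for \<iota> :: "'r::banach \<Rightarrow> 'c::complex_banach" +
  fixes K :: "'r set"
  assumes cone: "real_cone K"
begin

abbreviation "KC \<equiv> cone_complexification \<iota> K"
abbreviation "KC' \<equiv> complex_dual_cone \<iota> K"

text \<open>
  The bipolar theorem.
\<close>

lemma mem_cone_by_dual: "(\<And>l. l \<in> dual_cone K \<Longrightarrow> 0 \<le> blinfun_apply l x) \<Longrightarrow> x \<in> K"
  using cone_separation[OF cone] by (meson not_le)

text \<open>
  The complexified cone consists of the complex multiples of \<open>K + i K\<close>: rotate the values of all functionals
  of the dual cone into the first quadrant and read off that real and imaginary part belong to \<open>K\<close>.
\<close>

lemma cone_complexification_decompose: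
  assumes "x \<in> KC"
  shows "\<exists>c u v. c \<noteq> 0 \<and> u \<in> K \<and> v \<in> K \<and> c *\<^sub>C x = \<iota> u + \<i> *\<^sub>C \<iota> v"
proof -
  have "\<exists>c. c \<noteq> 0 \<and> (\<forall>z\<in>(\<lambda>l. pairing \<iota> l x) ` dual_cone K. 0 \<le> Re (c * z) \<and> 0 \<le> Im (c * z))"
    using assms unfolding cone_complexification_def by (intro sector_rotation) auto
  then obtain c where c: "c \<noteq> 0"
    and q: "\<And>l. l \<in> dual_cone K \<Longrightarrow> 0 \<le> Re (pairing \<iota> l (c *\<^sub>C x)) \<and> 0 \<le> Im (pairing \<iota> l (c *\<^sub>C x))"
    by (auto simp: pairing_scaleC)
  have "re_part (c *\<^sub>C x) \<in> K" "im_part (c *\<^sub>C x) \<in> K"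
    using q by (auto intro!: mem_cone_by_dual simp: pairing_eq)
  thus ?thesis using c decompose[of "c *\<^sub>C x"] by blast
qed

text \<open>
  The dual counterpart: up to a complex factor, a functional of the complex dual cone is \<open>f + i g\<close> with \<open>f\<close> and \<open>g\<close> in
  the real dual cone.
\<close>

lemma complex_dual_decompose:
  assumes \<nu>: "\<nu> \<in> KC'"
  shows "\<exists>c f g. c \<noteq> 0 \<and> f \<in> dual_cone K \<and> g \<in> dual_cone K \<and>
    (\<forall>x. c * \<nu> x = pairing \<iota> f x + \<i> * pairing \<iota> g x)"
proof -
  have bc: "bounded_clinear \<nu>" using \<nu> unfolding complex_dual_cone_def by blast
  have "\<exists>c. c \<noteq> 0 \<and> (\<forall>z\<in>(\<lambda>x. \<nu> (\<iota> x)) ` K. 0 \<le> Re (c * z) \<and> 0 \<le> Im (c * z))"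
    using \<nu> unfolding complex_dual_cone_def by (intro sector_rotation) auto
  then obtain c where c: "c \<noteq> 0"
    and q: "\<And>x. x \<in> K \<Longrightarrow> 0 \<le> Re (c * \<nu> (\<iota> x)) \<and> 0 \<le> Im (c * \<nu> (\<iota> x))" by auto
  have bl: "bounded_linear (\<lambda>u. c * \<nu> (\<iota> u))"
    using bc bounded_linear_emb unfolding bounded_clinear_def
    by (intro bounded_linear_mult_right[THEN bounded_linear_compose]) (auto intro: bounded_linear_compose)
  define f where "f = Blinfun (\<lambda>u. Re (c * \<nu> (\<iota> u)))"
  define g where "g = Blinfun (\<lambda>u. Im (c * \<nu> (\<iota> u)))"
  have f: "blinfun_apply f u = Re (c * \<nu> (\<iota> u))" for u
    unfolding f_def using bounded_linear_compose[OF bounded_linear_Re bl]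
    by (simp add: bounded_linear_Blinfun_apply)
  have g: "blinfun_apply g u = Im (c * \<nu> (\<iota> u))" for u
    unfolding g_def using bounded_linear_compose[OF bounded_linear_Im bl]
    by (simp add: bounded_linear_Blinfun_apply)
  have fg: "of_real (blinfun_apply f u) + \<i> * of_real (blinfun_apply g u) = c * \<nu> (\<iota> u)" for u
    unfolding f g by (metis complex_eq)
  have "c * \<nu> x = pairing \<iota> f x + \<i> * pairing \<iota> g x" for x
  proof -
    have "c * \<nu> x = c * \<nu> (\<iota> (re_part x)) + \<i> * (c * \<nu> (\<iota> (im_part x)))"
      by (subst clinear_eq_extension[OF bc]) (simp add: algebra_simps)
    thus ?thesis unfolding fg[symmetric] pairing_eq by (simp add: algebra_simps)
  qed
  moreover have "f \<in> dual_cone K" "g \<in> dual_cone K" unfolding dual_cone_def using q f g by auto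
  ultimately show ?thesis using c by blast
qed

lemma pairing_in_complex_dual: "l \<in> dual_cone K \<Longrightarrow> pairing \<iota> l \<in> KC'"
  unfolding complex_dual_cone_def dual_cone_def using bounded_clinear_pairing by auto

lemma crossed_pairing_in_complex_dual:
  assumes l: "l \<in> dual_cone K" "m \<in> dual_cone K" and \<alpha>\<beta>: "Re (\<alpha> * cnj \<beta>) \<ge> 0"
  shows "(\<lambda>x. \<alpha> * pairing \<iota> l x + \<beta> * pairing \<iota> m x) \<in> KC'"
  unfolding complex_dual_cone_def
proof (intro CollectI conjI ballI)
  show "bounded_clinear (\<lambda>x. \<alpha> * pairing \<iota> l x + \<beta> * pairing \<iota> m x)"
    by (intro bounded_clinear_lincomb bounded_clinear_pairing)
  fix u v assume uv: "u \<in> K" "v \<in> K"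
  let ?l = "blinfun_apply l" and ?m = "blinfun_apply m"
  have nn: "0 \<le> ?l u" "0 \<le> ?l v" "0 \<le> ?m u" "0 \<le> ?m v" using l uv unfolding dual_cone_def by auto
  have "Re ((\<alpha> * pairing \<iota> l (\<iota> u) + \<beta> * pairing \<iota> m (\<iota> u)) * cnj (\<alpha> * pairing \<iota> l (\<iota> v) + \<beta> * pairing \<iota> m (\<iota> v)))
    = (cmod \<alpha>)\<^sup>2 * (?l u * ?l v) + (cmod \<beta>)\<^sup>2 * (?m u * ?m v) + Re (\<alpha> * cnj \<beta>) * (?l u * ?m v + ?m u * ?l v)"
    unfolding cmod_power2 by (simp add: algebra_simps power2_eq_square)
  also have "\<dots> \<ge> 0" using nn \<alpha>\<beta> by (intro add_nonneg_nonneg mult_nonneg_nonneg) auto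
  finally show "0 \<le> Re ((\<alpha> * pairing \<iota> l (\<iota> u) + \<beta> * pairing \<iota> m (\<iota> u)) * cnj (\<alpha> * pairing \<iota> l (\<iota> v) + \<beta> * pairing \<iota> m (\<iota> v)))" .
qed

text \<open>
  Linear convexity of the complexified cone. A vector \<open>w\<close> outside it is annihilated by some functional
  \<open>\<mu>\<close> of the complex dual cone, a combination of two real functionals \<open>l\<close> and \<open>m\<close>. For \<open>w = x - z y\<close> this says
  \<open>\<mu> x = z * \<mu> y\<close>, which for \<open>|z| > b\<close> is compatible with \<open>|\<mu> x| \<le> b |\<mu> y|\<close> only if \<open>\<mu> y = 0\<close>. Then \<open>l\<close> and \<open>m\<close>
  vanish at \<open>y\<close>, hence at \<open>x\<close> and at \<open>w\<close>, contrary to the choice of \<open>l\<close> and \<open>m\<close>.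
\<close>

lemma pencil_in_cone:
  assumes y: "y \<in> KC" and le: "\<And>\<mu>. \<mu> \<in> KC' \<Longrightarrow> cmod (\<mu> x) \<le> b * cmod (\<mu> y)" and z: "b < cmod z"
  shows "x - z *\<^sub>C y \<in> KC"
proof (rule ccontr)
  assume "x - z *\<^sub>C y \<notin> KC"
  then obtain l m where l: "l \<in> dual_cone K" and m: "m \<in> dual_cone K"
    and neg: "Re (pairing \<iota> l (x - z *\<^sub>C y) * cnj (pairing \<iota> m (x - z *\<^sub>C y))) < 0"
    unfolding cone_complexification_def by (auto simp: not_le)
  define p q where "p = pairing \<iota> l (x - z *\<^sub>C y)" and "q = pairing \<iota> m (x - z *\<^sub>C y)"
  have pq: "Re (p * cnj q) < 0" using neg unfolding p_def q_def .
  define \<mu> where "\<mu> v = q * pairing \<iota> l v + (- p) * pairing \<iota> m v" for v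
  have \<mu>: "\<mu> \<in> KC'"
    unfolding \<mu>_def[abs_def] using pq by (intro crossed_pairing_in_complex_dual l m) (simp add: mult.commute)
  hence bc: "bounded_clinear \<mu>" unfolding complex_dual_cone_def by blast
  have "\<mu> (x - z *\<^sub>C y) = 0" unfolding \<mu>_def p_def q_def by simp
  hence xz: "\<mu> x = z * \<mu> y"
    by (simp add: bounded_clinear_diff[OF bc] bounded_clinear_scaleC[OF bc] scaleC_complex_def)
  with le[OF \<mu>] have "cmod z * cmod (\<mu> y) \<le> b * cmod (\<mu> y)" by (simp add: norm_mult)
  hence y0: "\<mu> y = 0" using z by (auto simp: mult_le_cancel_right)
  have pos: "0 \<le> Re (pairing \<iota> l y * cnj (pairing \<iota> m y))"
    using y l m unfolding cone_complexification_def by auto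
  have 1: "0 < Re (q * cnj (- p))" using pq by (simp add: mult.commute)
  have "\<not> half_plane_pair (pairing \<iota> l y) (pairing \<iota> m y)"
    using half_plane_pair_combination_nonzero[OF 1] y0 unfolding \<mu>_def by (metis mult.commute)
  hence ly: "pairing \<iota> l y = 0" "pairing \<iota> m y = 0" using pos unfolding half_plane_pair_def by auto
  have "cmod (pairing \<iota> l x) \<le> b * cmod (pairing \<iota> l y)" by (rule le[OF pairing_in_complex_dual[OF l]])
  hence "pairing \<iota> l x = 0" using ly by simp
  hence "p = 0" unfolding p_def using ly by (simp add: pairing_diff pairing_scaleC)
  thus False using pq by simp
qed

end

section \<open>The projective metric\<close>

lemma complex_dual_scaleR:
  "\<mu> \<in> complex_dual_cone \<iota> K \<Longrightarrow> cmod (\<mu> (t *\<^sub>R y)) = \<bar>t\<bar> * cmod (\<mu> y)"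
  unfolding complex_dual_cone_def by (auto simp: bounded_clinear_scaleR)

lemma cone_beta_le:
  assumes "0 \<le> t" "\<And>\<mu>. \<mu> \<in> complex_dual_cone \<iota> K \<Longrightarrow> cmod (\<mu> x) \<le> t * cmod (\<mu> y)"
  shows "cone_beta \<iota> K x y \<le> ereal t"
  unfolding cone_beta_def cone_le_def
  using assms by (intro Inf_lower) (auto simp: complex_dual_scaleR)

text \<open>
  If it is finite, the infimum is attained, because each condition on \<open>t\<close> is closed. The functional that does not
  vanish at \<open>x\<close> makes it positive.
\<close>

lemma cone_beta_cases:
  assumes \<mu>0: "\<mu>0 \<in> complex_dual_cone \<iota> K" "\<mu>0 x \<noteq> 0"
  obtains "cone_beta \<iota> K x y = \<infinity>"
  | b where "cone_beta \<iota> K x y = ereal b" "0 < b"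
      "\<And>\<mu>. \<mu> \<in> complex_dual_cone \<iota> K \<Longrightarrow> cmod (\<mu> x) \<le> b * cmod (\<mu> y)"
proof -
  define T where "T = {t. 0 \<le> t \<and> (\<forall>\<mu>\<in>complex_dual_cone \<iota> K. cmod (\<mu> x) \<le> t * cmod (\<mu> y))}"
  have beta: "cone_beta \<iota> K x y = Inf (ereal ` T)"
    unfolding cone_beta_def cone_le_def T_def
    by (rule arg_cong[of _ _ Inf]) (auto simp: complex_dual_scaleR)
  show ?thesis
  proof (cases "T = {}")
    case True
    thus ?thesis using that(1) beta by (simp add: top_ereal_def)
  next
    case False
    have bdd: "bdd_below T" unfolding T_def by (intro bdd_belowI[of _ 0]) auto
    have le: "cmod (\<mu> x) \<le> Inf T * cmod (\<mu> y)" if \<mu>: "\<mu> \<in> complex_dual_cone \<iota> K" for \<mu>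
    proof (cases "\<mu> y = 0")
      case True
      obtain t where "t \<in> T" using False by auto
      thus ?thesis using \<mu> True unfolding T_def by auto
    next
      case y: False
      have "cmod (\<mu> x) / cmod (\<mu> y) \<le> Inf T"
        using False y \<mu> by (intro cInf_greatest) (auto simp: T_def divide_simps)
      thus ?thesis using y by (simp add: divide_simps)
    qed
    have "0 < cmod (\<mu>0 x)" using \<mu>0 by simp
    also have "\<dots> \<le> Inf T * cmod (\<mu>0 y)" by (rule le[OF \<mu>0(1)])
    finally have pos: "0 < Inf T" by (simp add: zero_less_mult_iff)
    have inT: "Inf T \<in> T" using pos le unfolding T_def by auto
    have "Inf (ereal ` T) = ereal (Inf T)"
    proof (rule antisym)
      show "Inf (ereal ` T) \<le> ereal (Inf T)" using inT by (intro Inf_lower) auto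
      show "ereal (Inf T) \<le> Inf (ereal ` T)"
        by (intro Inf_greatest) (auto intro!: cInf_lower bdd)
    qed
    thus ?thesis using that(2)[of "Inf T"] beta pos le by simp
  qed
qed

text \<open>
  Formally \<open>cone_beta x y\<close> is the supremum of \<open>|\<mu> x| / |\<mu> y|\<close> and \<open>cone_beta y x\<close> is the reciprocal of the infimum, so
  their product is the supremum of the cross-ratios. To avoid quotients by 0 the bound
  is used in two steps: first for \<open>cone_beta x y\<close>, then for \<open>cone_beta y x\<close>.
\<close>

lemma projective_dist_le:
  assumes \<mu>0: "\<mu>0 \<in> complex_dual_cone \<iota> K" "\<mu>0 x \<noteq> 0" "\<mu>0 y \<noteq> 0"
    and R: "0 < R"
    and cross: "\<And>\<mu> \<nu>. \<mu> \<in> complex_dual_cone \<iota> K \<Longrightarrow> \<nu> \<in> complex_dual_cone \<iota> K \<Longrightarrow>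
      cmod (\<mu> x) * cmod (\<nu> y) \<le> R * (cmod (\<mu> y) * cmod (\<nu> x))"
  shows "projective_dist \<iota> K x y \<le> ereal (ln R)"
proof -
  have ub: "cone_beta \<iota> K x y \<le> ereal (R * cmod (\<nu> x) / cmod (\<nu> y))"
    if \<nu>: "\<nu> \<in> complex_dual_cone \<iota> K" "\<nu> y \<noteq> 0" for \<nu>
    using cross[OF _ \<nu>(1)] \<nu>(2) R by (intro cone_beta_le) (auto simp: field_simps)
  show ?thesis
  proof (rule cone_beta_cases[OF \<mu>0(1,2), of y])
    assume "cone_beta \<iota> K x y = \<infinity>"
    thus ?thesis using ub[OF \<mu>0(1,3)] by simp
  next
    fix b assume b: "cone_beta \<iota> K x y = ereal b" "0 < b"
    have "cmod (\<nu> y) \<le> R / b * cmod (\<nu> x)" if \<nu>: "\<nu> \<in> complex_dual_cone \<iota> K" for \<nu>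
    proof (cases "\<nu> y = 0")
      case False
      thus ?thesis using ub[OF \<nu> False] b by (simp add: field_simps)
    qed (use R b in simp)
    hence cb: "cone_beta \<iota> K y x \<le> ereal (R / b)" using R b by (intro cone_beta_le) auto
    show ?thesis
    proof (rule cone_beta_cases[OF \<mu>0(1,3), of x])
      assume "cone_beta \<iota> K y x = \<infinity>"
      thus ?thesis using cb by simp
    next
      fix c assume c: "cone_beta \<iota> K y x = ereal c" "0 < c"
      hence "b * c \<le> R" using cb b by (simp add: field_simps)
      hence "ln (b * c) \<le> ln R" using b c R by (intro ln_mono) auto
      thus ?thesis unfolding projective_dist_def log_ereal_def using b c by auto
    qed
  qed
qed

lemma projective_dist_cases:
  assumes \<mu>0: "\<mu>0 \<in> complex_dual_cone \<iota> K" "\<mu>0 x \<noteq> 0" "\<mu>0 y \<noteq> 0"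
  obtains "projective_dist \<iota> K x y = \<infinity>"
  | b c where "projective_dist \<iota> K x y = ereal (ln (b * c))" "0 < b" "0 < c"
      "\<And>\<mu>. \<mu> \<in> complex_dual_cone \<iota> K \<Longrightarrow> cmod (\<mu> x) \<le> b * cmod (\<mu> y)"
      "\<And>\<mu>. \<mu> \<in> complex_dual_cone \<iota> K \<Longrightarrow> cmod (\<mu> y) \<le> c * cmod (\<mu> x)"
proof (rule cone_beta_cases[OF \<mu>0(1,2), of y]; rule cone_beta_cases[OF \<mu>0(1,3), of x])
  fix b c
  assume "cone_beta \<iota> K x y = ereal b" "0 < b" "cone_beta \<iota> K y x = ereal c" "0 < c"
    "\<And>\<mu>. \<mu> \<in> complex_dual_cone \<iota> K \<Longrightarrow> cmod (\<mu> x) \<le> b * cmod (\<mu> y)"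
    "\<And>\<mu>. \<mu> \<in> complex_dual_cone \<iota> K \<Longrightarrow> cmod (\<mu> y) \<le> c * cmod (\<mu> x)"
  moreover from this have "\<not> b * c \<le> 0" by (simp add: not_le mult_pos_pos)
  ultimately show thesis
    by (intro that(2)[of b c]) (simp_all add: projective_dist_def log_ereal_def)
qed (auto intro!: that(1) simp: projective_dist_def log_ereal_def)

section \<open>Functionals on a generated cone\<close>

lemma nonneg_combinations_nonneg:
  assumes \<phi>: "linear (\<phi> :: 'v::real_vector \<Rightarrow> real)" and S: "\<And>s. s \<in> S \<Longrightarrow> 0 \<le> \<phi> s"
    and u: "u \<in> nonneg_combinations S"
  shows "0 \<le> \<phi> u"
proof -
  obtain F t where F: "F \<subseteq> S" "\<And>s. s \<in> F \<Longrightarrow> 0 \<le> t s" and eq: "u = (\<Sum>s\<in>F. t s *\<^sub>R s)"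
    using u unfolding nonneg_combinations_def by blast
  show ?thesis
    unfolding eq linear_sum[OF \<phi>] linear_scale[OF \<phi>] using F S by (intro sum_nonneg) auto
qed

lemma nonneg_combinations_pos:
  assumes \<phi>: "linear (\<phi> :: 'v::real_vector \<Rightarrow> real)" and S: "\<And>s. s \<in> S \<Longrightarrow> 0 < \<phi> s"
    and u: "u \<in> nonneg_combinations S" "u \<noteq> 0"
  shows "0 < \<phi> u"
proof -
  obtain F t where F: "finite F" "F \<subseteq> S" "\<And>s. s \<in> F \<Longrightarrow> 0 \<le> t s" and eq: "u = (\<Sum>s\<in>F. t s *\<^sub>R s)"
    using u(1) unfolding nonneg_combinations_def by blast
  have "\<exists>s\<in>F. t s \<noteq> 0" using u(2) unfolding eq by (metis (no_types, lifting) scaleR_zero_left sum.neutral)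
  then obtain s where s: "s \<in> F" "t s \<noteq> 0" by blast
  have "0 < t s * \<phi> s" using s F(2) F(3)[OF s(1)] S[of s] by (auto intro!: mult_pos_pos)
  hence "0 < (\<Sum>s\<in>F. t s * \<phi> s)"
    using s F(1)
  proof (intro sum_pos2[of F s])
    show "0 \<le> t i * \<phi> i" if "i \<in> F" for i using F that S[of i] by (intro mult_nonneg_nonneg) auto
  qed auto
  thus ?thesis unfolding eq linear_sum[OF \<phi>] linear_scale[OF \<phi>] by simp
qed

lemma generating_set_nonneg:
  assumes \<phi>: "bounded_linear (\<phi> :: 'r::banach \<Rightarrow> real)" and E: "\<And>e. e \<in> E \<Longrightarrow> 0 \<le> \<phi> e"
    and gen: "generating_set K E" and u: "u \<in> K"
  shows "0 \<le> \<phi> u"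
proof -
  have "nonneg_combinations E \<subseteq> {u. 0 \<le> \<phi> u}"
    using nonneg_combinations_nonneg[OF bounded_linear.linear[OF \<phi>] E] by blast
  moreover have "closed {u. 0 \<le> \<phi> u}"
    by (intro closed_Collect_le continuous_on_const linear_continuous_on \<phi>)
  ultimately have "closure (nonneg_combinations E) \<subseteq> {u. 0 \<le> \<phi> u}" by (rule closure_minimal)
  thus ?thesis using gen u unfolding generating_set_def by blast
qed

locale generated_cone = complex_cone \<iota> K for \<iota> :: "'r::banach \<Rightarrow> 'c::complex_banach" and K +
  fixes E :: "'r set"
  assumes generating: "generating_set K E" and archimedian: "archimedian K E"
begin

text \<open>
  The complexification of the two-dimensional cone spanned by \<open>e\<close> and \<open>f\<close>.
\<close>

definition edge_vectors :: "'r \<Rightarrow> 'r \<Rightarrow> 'c set" where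
  "edge_vectors e f = {\<alpha> *\<^sub>C \<iota> e + \<beta> *\<^sub>C \<iota> f |\<alpha> \<beta>. half_plane_pair \<alpha> \<beta>}"

lemma edge_vectors_ends: "\<iota> e \<in> edge_vectors e f" "\<iota> f \<in> edge_vectors e f"
  unfolding edge_vectors_def half_plane_pair_def
  by (force intro: exI[of _ 1] exI[of _ 0])+

lemma pairwise_nonneg_extends:
  assumes w: "bounded_clinear w"
    and E: "\<And>e f. e \<in> E \<Longrightarrow> f \<in> E \<Longrightarrow> 0 \<le> Re (w (\<iota> e) * cnj (w (\<iota> f)))"
    and uv: "u \<in> K" "v \<in> K"
  shows "0 \<le> Re (w (\<iota> u) * cnj (w (\<iota> v)))"
proof -
  have bl: "bounded_linear (\<lambda>u. Re (w (\<iota> u) * c))" for c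
    using w bounded_linear_emb unfolding bounded_clinear_def
    by (intro bounded_linear_Re[THEN bounded_linear_compose] bounded_linear_mult_left[THEN bounded_linear_compose])
       (auto intro: bounded_linear_compose)
  have sym: "Re (a * cnj b) = Re (b * cnj a)" for a b by (simp add: mult.commute)
  have one: "0 \<le> Re (w (\<iota> u) * cnj (w (\<iota> f)))" if "u \<in> K" "f \<in> E" for u f
    by (rule generating_set_nonneg[OF bl _ generating that(1)]) (use E that in auto)
  show ?thesis
    by (rule generating_set_nonneg[OF bl _ generating uv(1)]) (metis one[OF uv(2)] sym)
qed

text \<open>
  Closure preserves only weak inequalities. Strictness survives because the Archimedian property splits
  off a positive multiple of a generator from each vector.
\<close>

lemma pairwise_pos_extends:
  assumes w: "bounded_clinear w"
    and E: "\<And>e f. e \<in> E \<Longrightarrow> f \<in> E \<Longrightarrow> 0 < Re (w (\<iota> e) * cnj (w (\<iota> f)))"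
    and uv: "u \<in> K - {0}" "v \<in> K - {0}"
  shows "0 < Re (w (\<iota> u) * cnj (w (\<iota> v)))"
proof -
  obtain e s where e: "e \<in> E" "0 < s" "u - s *\<^sub>R e \<in> K" using archimedian uv(1) unfolding archimedian_def by blast
  obtain f t where f: "f \<in> E" "0 < t" "v - t *\<^sub>R f \<in> K" using archimedian uv(2) unfolding archimedian_def by blast
  have EK: "e \<in> K" "f \<in> K" using generating e(1) f(1) unfolding generating_set_def by auto
  have nn: "0 \<le> Re (w (\<iota> u) * cnj (w (\<iota> v)))" if "u \<in> K" "v \<in> K" for u v
    by (rule pairwise_nonneg_extends[OF w _ that]) (use E in \<open>auto intro: less_imp_le\<close>)
  define u' v' where "u' = u - s *\<^sub>R e" and "v' = v - t *\<^sub>R f"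
  have wl: "w (\<iota> (a + r *\<^sub>R b)) = w (\<iota> a) + of_real r * w (\<iota> b)" for a b r
    using w linear_emb by (simp add: bounded_clinear_add bounded_clinear_scaleR linear_add linear_scale scaleR_conv_of_real)
  have "u = u' + s *\<^sub>R e" "v = v' + t *\<^sub>R f" unfolding u'_def v'_def by simp_all
  hence "Re (w (\<iota> u) * cnj (w (\<iota> v))) = Re (w (\<iota> u') * cnj (w (\<iota> v'))) + t * Re (w (\<iota> u') * cnj (w (\<iota> f)))
      + s * Re (w (\<iota> e) * cnj (w (\<iota> v'))) + (s * t) * Re (w (\<iota> e) * cnj (w (\<iota> f)))"
    by (simp add: wl algebra_simps)
  also have "\<dots> > 0"
    using nn[OF e(3)[folded u'_def] f(3)[folded v'_def]] nn[OF e(3)[folded u'_def] EK(2)]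
      nn[OF EK(1) f(3)[folded v'_def]] e(2) f(2) E[OF e(1) f(1)]
    by (intro add_nonneg_pos add_nonneg_nonneg mult_pos_pos mult_nonneg_nonneg) auto
  finally show ?thesis .
qed

text \<open>
  Up to a factor \<open>x = u + i v\<close> with \<open>u, v \<in> K\<close>. If \<open>w u + i w v = 0\<close>, then \<open>w u\<close> and \<open>w v\<close> are orthogonal, which
  the strict inequality excludes unless \<open>u\<close> or \<open>v\<close> is 0.
\<close>

lemma pairwise_pos_nonvanishing:
  assumes w: "bounded_clinear w"
    and E: "\<And>e f. e \<in> E \<Longrightarrow> f \<in> E \<Longrightarrow> 0 < Re (w (\<iota> e) * cnj (w (\<iota> f)))"
    and x: "x \<in> KC - {0}"
  shows "w x \<noteq> 0"
proof
  assume w0: "w x = 0"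
  obtain c u v where c: "c \<noteq> 0" and uv: "u \<in> K" "v \<in> K" and eq: "c *\<^sub>C x = \<iota> u + \<i> *\<^sub>C \<iota> v"
    using cone_complexification_decompose x by blast
  have "w (\<iota> u) + \<i> * w (\<iota> v) = w (c *\<^sub>C x)"
    unfolding eq using w by (simp add: bounded_clinear_add bounded_clinear_scaleC scaleC_complex_def)
  also have "\<dots> = 0" using w w0 by (simp add: bounded_clinear_scaleC scaleC_complex_def)
  finally have sum: "1 * w (\<iota> u) + \<i> * w (\<iota> v) = 0" by simp
  note pos = pairwise_pos_extends[OF w E]
  have hp: "half_plane_pair 1 \<i>" unfolding half_plane_pair_def by simp
  have "u = 0 \<or> v = 0" using pos[of u v] half_plane_pair_combination_nonzero[OF _ hp] sum uv by blast
  moreover have "w (\<iota> 0) = 0" using w linear_emb by (simp add: linear_0 bounded_clinear_zero)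
  ultimately have "w (\<iota> u) = 0" "w (\<iota> v) = 0" using sum by auto
  hence "u = 0" "v = 0" using pos[of u u] pos[of v v] uv by auto
  hence "c *\<^sub>C x = 0" unfolding eq using linear_emb by (simp add: linear_0)
  thus False using c x by simp
qed

text \<open>
  The reduction to two generators: a hyperplane that meets the complexified cone already meets
  the complexification of a two-dimensional face spanned by generators. Some pair \<open>e, f\<close> violates the
  strict inequality, and \<open>w f\<close> times \<open>e\<close> minus \<open>w e\<close> times \<open>f\<close> is then a vector with admissible coefficients.
\<close>

lemma kernel_meets_edge:
  fixes w :: "'c \<Rightarrow> complex"
  assumes w: "bounded_clinear w" and x: "x \<in> KC - {0}" and w0: "w x = 0"
  obtains e f x' where "e \<in> E" "f \<in> E" "x' \<in> edge_vectors e f" "w x' = 0"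
proof -
  obtain e f where ef: "e \<in> E" "f \<in> E" and neg: "Re (w (\<iota> e) * cnj (w (\<iota> f))) \<le> 0"
    using pairwise_pos_nonvanishing[OF w _ x] w0 by (meson not_le)
  show ?thesis
  proof (cases "w (\<iota> e) = 0")
    case True
    thus ?thesis using that[OF ef edge_vectors_ends(1)] by blast
  next
    case False
    define x' where "x' = w (\<iota> f) *\<^sub>C \<iota> e + (- w (\<iota> e)) *\<^sub>C \<iota> f"
    have "x' \<in> edge_vectors e f"
      unfolding x'_def edge_vectors_def half_plane_pair_def using False neg
      by (intro CollectI exI conjI) (auto simp: mult.commute)
    moreover have "w x' = 0"
      unfolding x'_def using w by (simp add: bounded_clinear_add bounded_clinear_scaleC scaleC_complex_def)
    ultimately show ?thesis using that[OF ef] by blast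
  qed
qed

end

text \<open>
  Two families of ratios, each with spread at most \<open>D\<close>, are compared through one representative of each
  that also occur together in a third family.
\<close>

lemma ratio_chain:
  fixes D :: real
  assumes D: "0 \<le> D"
    and "p1 \<le> D * p2" "p2 \<le> D * p3" "p3 \<le> D * p4"
  shows "p1 \<le> D ^ 3 * p4"
proof -
  have "p2 \<le> D * (D * p4)" using assms(3) mult_left_mono[OF assms(4) D] by (rule order_trans)
  hence "p1 \<le> D * (D * (D * p4))" using assms(2) mult_left_mono[OF _ D] order_trans by blast
  thus ?thesis by (simp add: power3_eq_cube mult_ac)
qed

section \<open>Cross-ratio bounds for the operator\<close>

locale contraction_setting =
  X1: generated_cone \<iota>1 K1 E + X2: complex_cone \<iota>2 K2
  for \<iota>1 :: "'r1::banach \<Rightarrow> 'c1::complex_banach" and K1 E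
    and \<iota>2 :: "'r2::banach \<Rightarrow> 'c2::complex_banach" and K2 +
  fixes M :: "('r2 \<Rightarrow>\<^sub>L real) set" and A :: "'c1 \<Rightarrow> 'c2" and \<theta> :: real
  assumes A: "bounded_clinear A" and M: "weak_star_generating_set \<iota>2 K2 M"
    and X2_nontrivial: "\<exists>y::'r2. y \<noteq> 0"
    and \<theta>: "0 \<le> \<theta>" "\<theta> < 1"
    and test: "test_matrices \<iota>1 \<iota>2 A E M \<subseteq> Gamma_plus \<theta>"
begin

abbreviation pr :: "('r2 \<Rightarrow>\<^sub>L real) \<Rightarrow> 'c2 \<Rightarrow> complex" where "pr \<equiv> pairing \<iota>2"

text \<open>
  \<open>D = exp (delta1 \<theta>)\<close>, the bound for the cross-ratios of a single test matrix.
\<close>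

definition D :: real where "D = (1 + \<theta>) / (1 - \<theta>)"

lemma D_ge_1: "1 \<le> D" unfolding D_def using \<theta> by simp

lemma test_entries:
  assumes "e \<in> E" "f \<in> E" "m \<in> M" "n \<in> M"
  shows "Gamma_entries \<theta> (pr m (A (\<iota>1 e))) (pr n (A (\<iota>1 e))) (pr m (A (\<iota>1 f))) (pr n (A (\<iota>1 f)))"
proof -
  let ?T = "vector [vector [pr m (A (\<iota>1 e)), pr n (A (\<iota>1 e))],
              vector [pr m (A (\<iota>1 f)), pr n (A (\<iota>1 f))]] :: complex^2^2"
  have "?T \<in> test_matrices \<iota>1 \<iota>2 A E M" unfolding test_matrices_def using assms by blast
  hence G: "?T \<in> Gamma_plus \<theta>" using test by blast
  hence int: "Gamma_int_entries (pr m (A (\<iota>1 e))) (pr n (A (\<iota>1 e))) (pr m (A (\<iota>1 f))) (pr n (A (\<iota>1 f)))"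
    unfolding Gamma_plus_def Gamma_plus_int_def Gamma_int_entries_def by (simp add: Let_def)
  have "0 < Re (pr m (A (\<iota>1 e)) * cnj (pr n (A (\<iota>1 f))) + pr n (A (\<iota>1 e)) * cnj (pr m (A (\<iota>1 f))))"
    using int norm_ge_zero unfolding Gamma_int_entries_def by (meson le_less_trans)
  moreover have "cmod (pr m (A (\<iota>1 e)) * pr n (A (\<iota>1 f)) - pr n (A (\<iota>1 e)) * pr m (A (\<iota>1 f)))
      / Re (pr m (A (\<iota>1 e)) * cnj (pr n (A (\<iota>1 f))) + pr n (A (\<iota>1 e)) * cnj (pr m (A (\<iota>1 f)))) \<le> \<theta>"
    using G unfolding Gamma_plus_def Let_def by (simp only: mem_Collect_eq vector_2)
  ultimately show ?thesis unfolding Gamma_entries_def using int by (simp only: pos_divide_le_eq)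
qed

text \<open>
  The dual counterpart of \<open>edge_vectors\<close>.
\<close>

definition edge_functionals :: "('r2 \<Rightarrow>\<^sub>L real) \<Rightarrow> ('r2 \<Rightarrow>\<^sub>L real) \<Rightarrow> ('c2 \<Rightarrow> complex) set" where
  "edge_functionals m n = {\<lambda>y. \<alpha> * pr m y + \<beta> * pr n y |\<alpha> \<beta>. half_plane_pair \<alpha> \<beta>}"

lemma edge_functionals_ends: "pr m \<in> edge_functionals m n" "pr n \<in> edge_functionals m n"
proof -
  have "half_plane_pair 1 0" "half_plane_pair 0 1" unfolding half_plane_pair_def by auto
  moreover have "pr m = (\<lambda>y. 1 * pr m y + 0 * pr n y)" "pr n = (\<lambda>y. 0 * pr m y + 1 * pr n y)" by auto
  ultimately show "pr m \<in> edge_functionals m n" "pr n \<in> edge_functionals m n"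
    unfolding edge_functionals_def by blast+
qed

lemma edge_functionals_clinear: "\<mu> \<in> edge_functionals m n \<Longrightarrow> bounded_clinear \<mu>"
  unfolding edge_functionals_def by (auto intro!: bounded_clinear_lincomb X2.bounded_clinear_pairing)

lemma pr_A_combination: "pr m (A (\<alpha> *\<^sub>C x + \<beta> *\<^sub>C y)) = pr m (A x) * \<alpha> + pr m (A y) * \<beta>"
  using A by (simp add: bounded_clinear_add bounded_clinear_scaleC X2.pairing_add X2.pairing_scaleC mult.commute)

lemma edge_cross_ratio:
  assumes ef: "e \<in> E" "f \<in> E" and mn: "m \<in> M" "n \<in> M"
    and xy: "x \<in> X1.edge_vectors e f" "y \<in> X1.edge_vectors e f"
    and \<mu>\<nu>: "\<mu> \<in> edge_functionals m n" "\<nu> \<in> edge_functionals m n"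
  shows "cmod (\<mu> (A x) * \<nu> (A y)) \<le> D * cmod (\<nu> (A x) * \<mu> (A y))"
proof -
  obtain x1 x2 where x: "x = x1 *\<^sub>C \<iota>1 e + x2 *\<^sub>C \<iota>1 f" "half_plane_pair x1 x2"
    using xy(1) unfolding X1.edge_vectors_def by blast
  obtain y1 y2 where y: "y = y1 *\<^sub>C \<iota>1 e + y2 *\<^sub>C \<iota>1 f" "half_plane_pair y1 y2"
    using xy(2) unfolding X1.edge_vectors_def by blast
  obtain \<alpha>1 \<alpha>2 where \<alpha>: "\<mu> = (\<lambda>y. \<alpha>1 * pr m y + \<alpha>2 * pr n y)" "half_plane_pair \<alpha>1 \<alpha>2"
    using \<mu>\<nu>(1) unfolding edge_functionals_def by blast
  obtain \<beta>1 \<beta>2 where \<beta>: "\<nu> = (\<lambda>y. \<beta>1 * pr m y + \<beta>2 * pr n y)" "half_plane_pair \<beta>1 \<beta>2"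
    using \<mu>\<nu>(2) unfolding edge_functionals_def by blast
  show ?thesis
    unfolding x(1) y(1) \<alpha>(1) \<beta>(1) D_def pr_A_combination
    by (rule Gamma_entries_cross_ratio[OF test_entries[OF ef mn] \<theta> x(2) y(2) \<alpha>(2) \<beta>(2)])
qed

lemma edge_image_pairwise_pos:
  assumes ef: "e \<in> E" "f \<in> E" and mn: "m \<in> M" "n \<in> M" and x: "x \<in> X1.edge_vectors e f"
  shows "0 < Re (pr m (A x) * cnj (pr n (A x)))"
proof -
  obtain x1 x2 where x: "x = x1 *\<^sub>C \<iota>1 e + x2 *\<^sub>C \<iota>1 f" "half_plane_pair x1 x2"
    using x unfolding X1.edge_vectors_def by blast
  show ?thesis unfolding x(1) pr_A_combination
    using test_entries[OF ef mn] x(2) unfolding Gamma_entries_def by (intro Gamma_int_entries_maps) auto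
qed

text \<open>
  The conditions on the matrices are invariant under transposition, so test matrices also act on
  pairs of coefficients of functionals.
\<close>

lemma edge_functional_pullback_pos:
  assumes ef: "e \<in> E" "f \<in> E" and mn: "m \<in> M" "n \<in> M" and \<mu>: "\<mu> \<in> edge_functionals m n"
  shows "0 < Re (\<mu> (A (\<iota>1 e)) * cnj (\<mu> (A (\<iota>1 f))))"
proof -
  obtain \<alpha>1 \<alpha>2 where \<alpha>: "\<mu> = (\<lambda>y. \<alpha>1 * pr m y + \<alpha>2 * pr n y)" "half_plane_pair \<alpha>1 \<alpha>2"
    using \<mu> unfolding edge_functionals_def by blast
  have "Gamma_int_entries (pr m (A (\<iota>1 e))) (pr m (A (\<iota>1 f))) (pr n (A (\<iota>1 e))) (pr n (A (\<iota>1 f)))"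
    by (rule Gamma_int_entries_transpose) (use test_entries[OF ef mn] in \<open>simp only: Gamma_entries_def\<close>)
  from Gamma_int_entries_maps[OF this \<alpha>(2)] show ?thesis unfolding \<alpha>(1) by (simp only: mult.commute)
qed

lemma edge_functional_nonvanishing:
  assumes mn: "m \<in> M" "n \<in> M" and \<mu>: "\<mu> \<in> edge_functionals m n" and x: "x \<in> X1.KC - {0}"
  shows "\<mu> (A x) \<noteq> 0"
  by (rule X1.pairwise_pos_nonvanishing[OF bounded_clinear_compose[OF edge_functionals_clinear[OF \<mu>] A] _ x])
     (rule edge_functional_pullback_pos[OF _ _ mn \<mu>])

text \<open>
  Otherwise \<open>n (A x)\<close> times \<open>m\<close> minus \<open>m (A x)\<close> times \<open>n\<close> would be an edge functional that vanishes at \<open>A x\<close>.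
\<close>

lemma image_pairwise_pos:
  assumes mn: "m \<in> M" "n \<in> M" and x: "x \<in> X1.KC - {0}"
  shows "0 < Re (pr m (A x) * cnj (pr n (A x)))"
proof (rule ccontr)
  assume "\<not> ?thesis"
  moreover have "pr m (A x) \<noteq> 0"
    by (rule edge_functional_nonvanishing[OF mn edge_functionals_ends(1) x])
  ultimately have "half_plane_pair (pr n (A x)) (- pr m (A x))"
    unfolding half_plane_pair_def by (auto simp: mult.commute)
  hence "(\<lambda>y. pr n (A x) * pr m y + (- pr m (A x)) * pr n y) \<in> edge_functionals m n"
    unfolding edge_functionals_def by blast
  from edge_functional_nonvanishing[OF mn this x] show False by simp
qed

text \<open>
  The ratio \<open>\<rho> x = |\<mu> (A x)| / |\<nu> (A x)|\<close> is studied for fixed \<open>\<mu>\<close> and \<open>\<nu>\<close>. Every value of \<open>\<mu> (A x) / \<nu> (A x)\<close> is attained on an edge,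
  since \<open>\<nu> (A x) \<mu> - \<mu> (A x) \<nu>\<close>, pulled back by \<open>A\<close>, has a zero there. On one edge \<open>\<rho>\<close> varies by a factor of at most \<open>D\<close>. Two
  edges are joined by the edge through a generator of each, which gives the third power.
\<close>

lemma cone_cross_ratio_edge_functionals:
  assumes mn: "m \<in> M" "n \<in> M" and \<mu>\<nu>: "\<mu> \<in> edge_functionals m n" "\<nu> \<in> edge_functionals m n"
    and xy: "x \<in> X1.KC - {0}" "y \<in> X1.KC - {0}"
  shows "cmod (\<mu> (A x) * \<nu> (A y)) \<le> D ^ 3 * cmod (\<nu> (A x) * \<mu> (A y))"
proof -
  note bc = edge_functionals_clinear[OF \<mu>\<nu>(1), THEN bounded_clinear_compose[OF _ A]]
    edge_functionals_clinear[OF \<mu>\<nu>(2), THEN bounded_clinear_compose[OF _ A]]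
  have nz: "\<nu> (A x) \<noteq> 0" "\<nu> (A y) \<noteq> 0"
    by (rule edge_functional_nonvanishing[OF mn \<mu>\<nu>(2) xy(1)], rule edge_functional_nonvanishing[OF mn \<mu>\<nu>(2) xy(2)])
  have nze: "\<nu> (A z) \<noteq> 0" if "e \<in> E" "f \<in> E" "z \<in> X1.edge_vectors e f" for e f z
  proof -
    obtain \<beta>1 \<beta>2 where \<beta>: "\<nu> = (\<lambda>y. \<beta>1 * pr m y + \<beta>2 * pr n y)" "half_plane_pair \<beta>1 \<beta>2"
      using \<mu>\<nu>(2) unfolding edge_functionals_def by blast
    show ?thesis unfolding \<beta>(1)
      by (rule half_plane_pair_combination_nonzero[OF edge_image_pairwise_pos[OF that(1,2) mn that(3)] \<beta>(2)])
  qed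
  define \<rho> where "\<rho> z = cmod (\<mu> (A z)) / cmod (\<nu> (A z))" for z
  have red: "\<exists>e\<in>E. \<exists>f\<in>E. \<exists>z'\<in>X1.edge_vectors e f. \<rho> z' = \<rho> z" if z: "z \<in> X1.KC - {0}" "\<nu> (A z) \<noteq> 0" for z
  proof -
    define w where "w v = \<nu> (A z) * \<mu> (A v) + (- \<mu> (A z)) * \<nu> (A v)" for v
    have "bounded_clinear w" unfolding w_def by (intro bounded_clinear_lincomb bc)
    moreover have "w z = 0" unfolding w_def by simp
    ultimately obtain e f z' where z': "e \<in> E" "f \<in> E" "z' \<in> X1.edge_vectors e f" "w z' = 0"
      using X1.kernel_meets_edge z(1) by blast
    have "\<nu> (A z) * \<mu> (A z') = \<mu> (A z) * \<nu> (A z')" using z'(4) unfolding w_def by simp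
    hence "cmod (\<nu> (A z)) * cmod (\<mu> (A z')) = cmod (\<mu> (A z)) * cmod (\<nu> (A z'))" by (metis norm_mult)
    hence "\<rho> z' = \<rho> z" unfolding \<rho>_def using z(2) nze[OF z'(1-3)] by (simp add: field_simps)
    thus ?thesis using z' by blast
  qed
  have step: "\<rho> z \<le> D * \<rho> z'" if "e \<in> E" "f \<in> E" "z \<in> X1.edge_vectors e f" "z' \<in> X1.edge_vectors e f" for e f z z'
    using edge_cross_ratio[OF that(1,2) mn that(3,4) \<mu>\<nu>] nze[OF that(1-3)] nze[OF that(1,2,4)]
    unfolding \<rho>_def by (simp add: norm_mult field_simps)
  obtain e f x' where x': "e \<in> E" "f \<in> E" "x' \<in> X1.edge_vectors e f" "\<rho> x' = \<rho> x" using red[OF xy(1) nz(1)] by blast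
  obtain e' f' y' where y': "e' \<in> E" "f' \<in> E" "y' \<in> X1.edge_vectors e' f'" "\<rho> y' = \<rho> y" using red[OF xy(2) nz(2)] by blast
  have "\<rho> x' \<le> D ^ 3 * \<rho> y'"
    using D_ge_1 step[OF x'(1-3) X1.edge_vectors_ends(1)] step[OF x'(1) y'(1) X1.edge_vectors_ends]
      step[OF y'(1,2) X1.edge_vectors_ends(1) y'(3)]
    by (intro ratio_chain[of D]) auto
  thus ?thesis unfolding x'(4) y'(4) unfolding \<rho>_def using nz by (simp add: norm_mult field_simps)
qed

text \<open>
  Up to complex factors these functionals are dense in the complex dual cone, in the weak-* sense.
\<close>

definition quadrant_combinations :: "('c2 \<Rightarrow> complex) set" where
  "quadrant_combinations = {\<lambda>y. pr f y + \<i> * pr g y |f g. f \<in> nonneg_combinations M \<and> g \<in> nonneg_combinations M}"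

text \<open>
  \<open>\<nu> = f + i g\<close>, and \<open>f w\<close> and \<open>g w\<close> have positive real inner product unless \<open>f\<close> or \<open>g\<close> is 0.
\<close>

lemma quadrant_combination_nonvanishing:
  assumes \<nu>: "\<nu> \<in> quadrant_combinations" "\<nu> z \<noteq> 0"
    and w: "\<And>m n. m \<in> M \<Longrightarrow> n \<in> M \<Longrightarrow> 0 < Re (pr m w * cnj (pr n w))"
  shows "\<nu> w \<noteq> 0"
proof
  assume w0: "\<nu> w = 0"
  obtain f g where fg: "f \<in> nonneg_combinations M" "g \<in> nonneg_combinations M" and \<nu>eq: "\<nu> = (\<lambda>y. pr f y + \<i> * pr g y)"
    using \<nu>(1) unfolding quadrant_combinations_def by blast
  have lin: "linear (\<lambda>l. Re (pr l w * c))" for c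
    by (rule linearI) (simp_all add: X2.pairing_eq blinfun.add_left blinfun.scaleR_left algebra_simps)
  have sym: "Re (a * cnj b) = Re (b * cnj a)" for a b by (simp add: mult.commute)
  have one: "0 < Re (pr h w * cnj (pr n w))" if "h \<in> nonneg_combinations M" "h \<noteq> 0" "n \<in> M" for h n
    by (rule nonneg_combinations_pos[OF lin _ that(1,2)]) (use w that(3) in auto)
  have two: "0 < Re (pr h w * cnj (pr k w))"
    if "h \<in> nonneg_combinations M" "h \<noteq> 0" "k \<in> nonneg_combinations M" "k \<noteq> 0" for h k
    by (rule nonneg_combinations_pos[OF lin _ that(1,2)]) (metis one[OF that(3,4)] sym)
  have sum: "1 * pr f w + \<i> * pr g w = 0" using w0 unfolding \<nu>eq by simp
  have hp: "half_plane_pair 1 \<i>" unfolding half_plane_pair_def by simp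
  have "f = 0 \<or> g = 0" using two[OF fg(1) _ fg(2)] half_plane_pair_combination_nonzero[OF _ hp] sum by blast
  moreover have z0: "pr 0 v = 0" for v by (simp add: X2.pairing_eq)
  ultimately have "pr f w = 0" "pr g w = 0" using sum by auto
  hence "f = 0" "g = 0" using two[OF fg(1) _ fg(1)] two[OF fg(2) _ fg(2)] by auto
  thus False using \<nu>(2) unfolding \<nu>eq by (simp add: z0)
qed

lemma kernel_meets_edge_functional:
  assumes \<nu>: "\<nu> \<in> quadrant_combinations" "\<nu> z \<noteq> 0" and w0: "\<nu> w = 0"
  obtains m n \<mu> where "m \<in> M" "n \<in> M" "\<mu> \<in> edge_functionals m n" "\<mu> w = 0"
proof -
  obtain m n where mn: "m \<in> M" "n \<in> M" and neg: "Re (pr m w * cnj (pr n w)) \<le> 0"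
    using quadrant_combination_nonvanishing[OF \<nu>] w0 by (meson not_le)
  show ?thesis
  proof (cases "pr m w = 0")
    case True
    thus ?thesis using that[OF mn edge_functionals_ends(1)] by blast
  next
    case False
    hence "half_plane_pair (pr n w) (- pr m w)" using neg unfolding half_plane_pair_def by (auto simp: mult.commute)
    hence "(\<lambda>y. pr n w * pr m y + (- pr m w) * pr n y) \<in> edge_functionals m n"
      unfolding edge_functionals_def by blast
    from that[OF mn this] show ?thesis by simp
  qed
qed

text \<open>
  The dual of the preceding reduction: now \<open>x\<close> and \<open>y\<close> are fixed, the functional varies, and edges of functionals
  replace edges of vectors. On each edge the ratio varies by a factor of at most \<open>D ^ 3\<close>, and the passage
  between two edges cubes it once more.
\<close>

lemma cone_cross_ratio_quadrant:
  assumes \<mu>\<nu>: "\<mu> \<in> quadrant_combinations" "\<nu> \<in> quadrant_combinations"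
    and xy: "x \<in> X1.KC - {0}" "y \<in> X1.KC - {0}"
  shows "cmod (\<mu> (A x) * \<nu> (A y)) \<le> D ^ 9 * cmod (\<nu> (A x) * \<mu> (A y))"
proof (cases "\<mu> (A x) = 0 \<or> \<nu> (A y) = 0")
  case True
  thus ?thesis using D_ge_1 by auto
next
  case False
  note pos = image_pairwise_pos[OF _ _ xy(1)] image_pairwise_pos[OF _ _ xy(2)]
  have nz: "\<mu> (A x) \<noteq> 0" "\<mu> (A y) \<noteq> 0" "\<nu> (A x) \<noteq> 0" "\<nu> (A y) \<noteq> 0"
    using False quadrant_combination_nonvanishing[OF \<mu>\<nu>(1) _ pos(2)]
      quadrant_combination_nonvanishing[OF \<mu>\<nu>(2) _ pos(1)] by auto
  define \<rho> where "\<rho> \<kappa> = cmod (\<kappa> (A x)) / cmod (\<kappa> (A y))" for \<kappa> :: "'c2 \<Rightarrow> complex"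
  have nze: "\<kappa> (A x) \<noteq> 0" "\<kappa> (A y) \<noteq> 0" if "m \<in> M" "n \<in> M" "\<kappa> \<in> edge_functionals m n" for m n \<kappa>
    using edge_functional_nonvanishing[OF that] xy by blast+
  have red: "\<exists>m\<in>M. \<exists>n\<in>M. \<exists>\<kappa>'\<in>edge_functionals m n. \<rho> \<kappa>' = \<rho> \<kappa>"
    if \<kappa>: "\<kappa> \<in> quadrant_combinations" "\<kappa> (A x) \<noteq> 0" "\<kappa> (A y) \<noteq> 0" for \<kappa>
  proof -
    obtain f g where \<kappa>eq: "\<kappa> = (\<lambda>y. pr f y + \<i> * pr g y)" using \<kappa>(1) unfolding quadrant_combinations_def by blast
    define w where "w = \<kappa> (A y) *\<^sub>C A x - \<kappa> (A x) *\<^sub>C A y"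
    have "\<kappa> w = \<kappa> (A y) * \<kappa> (A x) - \<kappa> (A x) * \<kappa> (A y)"
      unfolding w_def \<kappa>eq by (simp add: X2.pairing_diff X2.pairing_scaleC algebra_simps)
    hence "\<kappa> w = 0" by simp
    then obtain m n \<kappa>' where k: "m \<in> M" "n \<in> M" "\<kappa>' \<in> edge_functionals m n" "\<kappa>' w = 0"
      using kernel_meets_edge_functional[OF \<kappa>(1,2)] by blast
    have bc: "bounded_clinear \<kappa>'" by (rule edge_functionals_clinear[OF k(3)])
    have "\<kappa> (A y) * \<kappa>' (A x) = \<kappa> (A x) * \<kappa>' (A y)"
      using k(4) unfolding w_def
      by (simp add: bounded_clinear_diff[OF bc] bounded_clinear_scaleC[OF bc] scaleC_complex_def)
    hence "cmod (\<kappa> (A y)) * cmod (\<kappa>' (A x)) = cmod (\<kappa> (A x)) * cmod (\<kappa>' (A y))" by (metis norm_mult)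
    hence "\<rho> \<kappa>' = \<rho> \<kappa>" unfolding \<rho>_def using \<kappa> nze[OF k(1-3)] by (simp add: field_simps)
    thus ?thesis using k by blast
  qed
  have step: "\<rho> \<kappa> \<le> D ^ 3 * \<rho> \<kappa>'"
    if "m \<in> M" "n \<in> M" "\<kappa> \<in> edge_functionals m n" "\<kappa>' \<in> edge_functionals m n" for m n \<kappa> \<kappa>'
    using cone_cross_ratio_edge_functionals[OF that xy] nze[OF that(1-3)] nze[OF that(1,2,4)]
    unfolding \<rho>_def by (simp add: norm_mult field_simps)
  obtain m n \<mu>' where m: "m \<in> M" "n \<in> M" "\<mu>' \<in> edge_functionals m n" "\<rho> \<mu>' = \<rho> \<mu>"
    using red[OF \<mu>\<nu>(1) nz(1,2)] by blast
  obtain m' n' \<nu>' where n: "m' \<in> M" "n' \<in> M" "\<nu>' \<in> edge_functionals m' n'" "\<rho> \<nu>' = \<rho> \<nu>"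
    using red[OF \<mu>\<nu>(2) nz(3,4)] by blast
  have "\<rho> \<mu>' \<le> (D ^ 3) ^ 3 * \<rho> \<nu>'"
  proof (rule ratio_chain)
    show "0 \<le> D ^ 3" using D_ge_1 by simp
    show "\<rho> \<mu>' \<le> D ^ 3 * \<rho> (pr m)" by (rule step[OF m(1-3) edge_functionals_ends(1)])
    show "\<rho> (pr m) \<le> D ^ 3 * \<rho> (pr m')" by (rule step[OF m(1) n(1) edge_functionals_ends])
    show "\<rho> (pr m') \<le> D ^ 3 * \<rho> \<nu>'" by (rule step[OF n(1,2) edge_functionals_ends(1) n(3)])
  qed
  thus ?thesis unfolding m(4) n(4) unfolding \<rho>_def using nz by (simp add: norm_mult field_simps flip: power_mult)
qed

lemma weak_star_sequence:
  assumes l: "l \<in> dual_cone K2" and Y: "finite Y"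
  obtains L where "\<And>k. L k \<in> nonneg_combinations M" "\<And>y. y \<in> Y \<Longrightarrow> (\<lambda>k. pr (L k) y) \<longlonglongrightarrow> pr l y"
proof -
  have "\<exists>h\<in>nonneg_combinations M. \<forall>y\<in>Y. cmod (pr h y - pr l y) < inverse (real (Suc k))" for k
  proof -
    have "\<forall>\<epsilon>>0. \<exists>h\<in>nonneg_combinations M. \<forall>y\<in>Y. cmod (pr h y - pr l y) < \<epsilon>"
      using M l Y unfolding weak_star_generating_set_def by blast
    thus ?thesis by (meson inverse_positive_iff_positive of_nat_0_less_iff zero_less_Suc)
  qed
  then obtain L where L: "\<And>k. L k \<in> nonneg_combinations M"
    "\<And>k y. y \<in> Y \<Longrightarrow> cmod (pr (L k) y - pr l y) < inverse (real (Suc k))" by metis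
  have "(\<lambda>k. pr (L k) y) \<longlonglongrightarrow> pr l y" if "y \<in> Y" for y
    by (rule LIM_zero_cancel, rule Lim_null_comparison[OF _ LIMSEQ_inverse_real_of_nat])
       (use L(2)[OF that] in \<open>auto intro!: always_eventually less_imp_le\<close>)
  thus ?thesis using that L(1) by blast
qed

lemma complex_dual_sequence:
  assumes \<nu>: "\<nu> \<in> X2.KC'" and Y: "finite Y"
  obtains c N where "c \<noteq> 0" "\<And>k. N k \<in> quadrant_combinations" "\<And>y. y \<in> Y \<Longrightarrow> (\<lambda>k. N k y) \<longlonglongrightarrow> c * \<nu> y"
proof -
  obtain c f g where c: "c \<noteq> 0" and fg: "f \<in> dual_cone K2" "g \<in> dual_cone K2"
    and eq: "\<And>x. c * \<nu> x = pr f x + \<i> * pr g x" using X2.complex_dual_decompose[OF \<nu>] by blast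
  obtain L where L: "\<And>k. L k \<in> nonneg_combinations M" "\<And>y. y \<in> Y \<Longrightarrow> (\<lambda>k. pr (L k) y) \<longlonglongrightarrow> pr f y"
    using weak_star_sequence[OF fg(1) Y] by blast
  obtain L' where L': "\<And>k. L' k \<in> nonneg_combinations M" "\<And>y. y \<in> Y \<Longrightarrow> (\<lambda>k. pr (L' k) y) \<longlonglongrightarrow> pr g y"
    using weak_star_sequence[OF fg(2) Y] by blast
  show ?thesis
  proof (rule that[OF c, of "\<lambda>k y. pr (L k) y + \<i> * pr (L' k) y"])
    show "(\<lambda>y. pr (L k) y + \<i> * pr (L' k) y) \<in> quadrant_combinations" for k
      unfolding quadrant_combinations_def using L(1) L'(1) by blast
    show "(\<lambda>k. pr (L k) y + \<i> * pr (L' k) y) \<longlonglongrightarrow> c * \<nu> y" if "y \<in> Y" for y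
      unfolding eq by (intro tendsto_intros L(2) L'(2) that)
  qed
qed

text \<open>
  The image of the complexified cone has projective diameter at most \<open>9 * delta1 \<theta>\<close>. The bound for quadrant
  combinations is a weak inequality between continuous functions of the four values involved, so it
  passes to weak-* limits.
\<close>

lemma cone_cross_ratio:
  assumes \<mu>\<nu>: "\<mu> \<in> X2.KC'" "\<nu> \<in> X2.KC'"
    and xy: "x \<in> X1.KC - {0}" "y \<in> X1.KC - {0}"
  shows "cmod (\<mu> (A x)) * cmod (\<nu> (A y)) \<le> D ^ 9 * (cmod (\<nu> (A x)) * cmod (\<mu> (A y)))"
proof -
  have fin: "finite {A x, A y}" by simp
  obtain c P where c: "c \<noteq> 0" and P: "\<And>k. P k \<in> quadrant_combinations"
    and Pl: "\<And>y'. y' \<in> {A x, A y} \<Longrightarrow> (\<lambda>k. P k y') \<longlonglongrightarrow> c * \<mu> y'"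
    using complex_dual_sequence[OF \<mu>\<nu>(1) fin] by blast
  obtain d Q where d: "d \<noteq> 0" and Q: "\<And>k. Q k \<in> quadrant_combinations"
    and Ql: "\<And>y'. y' \<in> {A x, A y} \<Longrightarrow> (\<lambda>k. Q k y') \<longlonglongrightarrow> d * \<nu> y'"
    using complex_dual_sequence[OF \<mu>\<nu>(2) fin] by blast
  have "cmod ((c * \<mu> (A x)) * (d * \<nu> (A y))) \<le> D ^ 9 * cmod ((d * \<nu> (A x)) * (c * \<mu> (A y)))"
  proof (rule LIMSEQ_le)
    show "(\<lambda>k. cmod (P k (A x) * Q k (A y))) \<longlonglongrightarrow> cmod ((c * \<mu> (A x)) * (d * \<nu> (A y)))"
      by (intro tendsto_intros Pl Ql) auto
    show "(\<lambda>k. D ^ 9 * cmod (Q k (A x) * P k (A y))) \<longlonglongrightarrow> D ^ 9 * cmod ((d * \<nu> (A x)) * (c * \<mu> (A y)))"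
      by (intro tendsto_intros Pl Ql) auto
  qed (use cone_cross_ratio_quadrant[OF P Q xy] in blast)
  hence "(cmod c * cmod d) * (cmod (\<mu> (A x)) * cmod (\<nu> (A y)))
      \<le> (cmod c * cmod d) * (D ^ 9 * (cmod (\<nu> (A x)) * cmod (\<mu> (A y))))"
    by (simp add: norm_mult mult_ac)
  moreover have "0 < cmod c * cmod d" using c d by simp
  ultimately show ?thesis by (meson mult_le_cancel_left_pos)
qed

text \<open>
  Since \<open>K2\<close> is not the whole space, its dual cone is not 0.
\<close>

lemma M_nonempty: "M \<noteq> {}"
proof
  assume M0: "M = {}"
  obtain y0 :: 'r2 where y0: "y0 \<noteq> 0" using X2_nontrivial by blast
  hence "\<exists>y. y \<notin> K2" using real_cone_antisym[OF X2.cone] by blast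
  then obtain y l where l: "l \<in> dual_cone K2" "blinfun_apply l y < 0"
    using cone_separation[OF X2.cone] by blast
  have fin: "finite {\<iota>2 y}" by simp
  obtain L where L: "\<And>k. L k \<in> nonneg_combinations M" "\<And>v. v \<in> {\<iota>2 y} \<Longrightarrow> (\<lambda>k. pr (L k) v) \<longlonglongrightarrow> pr l v"
    using weak_star_sequence[OF l(1) fin] by blast
  have "L k = 0" for k using L(1)[of k] unfolding M0 nonneg_combinations_def by auto
  hence "(\<lambda>k. 0) \<longlonglongrightarrow> pr l (\<iota>2 y)" using L(2)[of "\<iota>2 y"] by (simp add: X2.pairing_eq)
  hence "pr l (\<iota>2 y) = 0" by (simp add: LIMSEQ_const_iff)
  thus False using l(2) by simp
qed

lemma image_in_cone:
  assumes x: "x \<in> X1.KC - {0}"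
  shows "A x \<in> X2.KC - {0}"
proof -
  have "0 \<le> Re (pr l (A x) * cnj (pr h (A x)))" if lh: "l \<in> dual_cone K2" "h \<in> dual_cone K2" for l h
  proof -
    have fin: "finite {A x}" by simp
    obtain L where L: "\<And>k. L k \<in> nonneg_combinations M" "\<And>v. v \<in> {A x} \<Longrightarrow> (\<lambda>k. pr (L k) v) \<longlonglongrightarrow> pr l v"
      using weak_star_sequence[OF lh(1) fin] by blast
    obtain H where H: "\<And>k. H k \<in> nonneg_combinations M" "\<And>v. v \<in> {A x} \<Longrightarrow> (\<lambda>k. pr (H k) v) \<longlonglongrightarrow> pr h v"
      using weak_star_sequence[OF lh(2) fin] by blast
    have lin: "linear (\<lambda>l. Re (pr l (A x) * c))" for c
      by (rule linearI) (simp_all add: X2.pairing_eq blinfun.add_left blinfun.scaleR_left algebra_simps)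
    have sym: "Re (a * cnj b) = Re (b * cnj a)" for a b by (simp add: mult.commute)
    have one: "0 \<le> Re (pr u (A x) * cnj (pr n (A x)))" if "u \<in> nonneg_combinations M" "n \<in> M" for u n
      by (rule nonneg_combinations_nonneg[OF lin _ that(1)])
         (use image_pairwise_pos[OF _ that(2) x] in \<open>auto intro: less_imp_le\<close>)
    have two: "0 \<le> Re (pr u (A x) * cnj (pr v (A x)))" if "u \<in> nonneg_combinations M" "v \<in> nonneg_combinations M" for u v
      by (rule nonneg_combinations_nonneg[OF lin _ that(1)]) (metis one[OF that(2)] sym)
    have "(\<lambda>k. Re (pr (L k) (A x) * cnj (pr (H k) (A x)))) \<longlonglongrightarrow> Re (pr l (A x) * cnj (pr h (A x)))"
      by (intro tendsto_intros L(2) H(2)) auto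
    thus ?thesis by (rule LIMSEQ_le_const) (use two[OF L(1) H(1)] in blast)
  qed
  moreover have "A x \<noteq> 0"
  proof
    assume "A x = 0"
    moreover obtain m where "m \<in> M" using M_nonempty by blast
    ultimately show False
      using image_pairwise_pos[OF _ _ x, of m m] bounded_clinear_zero[OF X2.bounded_clinear_pairing] by simp
  qed
  ultimately show ?thesis unfolding cone_complexification_def by blast
qed

text \<open>
  For a quadrant combination \<open>N\<close> with \<open>Re (N (A e) * cnj (N (A f))) < 0\<close>, the vector \<open>N (A f) e - N (A e) f\<close>
  would lie on the edge of \<open>e\<close> and \<open>f\<close>, and its image would be a zero of \<open>N\<close>. The general case follows by weak-* limits and then
  by extension from the generators to the cone.
\<close>

lemma pullback_in_complex_dual:
  assumes \<nu>: "\<nu> \<in> X2.KC'"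
  shows "(\<lambda>x. \<nu> (A x)) \<in> X1.KC'"
proof -
  have quad: "0 \<le> Re (N (A (\<iota>1 e)) * cnj (N (A (\<iota>1 f))))"
    if N: "N \<in> quadrant_combinations" and ef: "e \<in> E" "f \<in> E" for N e f
  proof (rule ccontr)
    assume neg: "\<not> ?thesis"
    let ?u = "N (A (\<iota>1 e))" and ?v = "N (A (\<iota>1 f))"
    define x where "x = ?v *\<^sub>C \<iota>1 e + (- ?u) *\<^sub>C \<iota>1 f"
    have nz: "?u \<noteq> 0" using neg by auto
    have "half_plane_pair ?v (- ?u)" using neg nz unfolding half_plane_pair_def by (auto simp: mult.commute)
    hence x: "x \<in> X1.edge_vectors e f" unfolding x_def X1.edge_vectors_def by blast
    obtain g h where eq: "N = (\<lambda>y. pr g y + \<i> * pr h y)" using N unfolding quadrant_combinations_def by blast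
    have "N (A x) = ?v * ?u + (- ?u) * ?v"
      unfolding x_def eq pr_A_combination by (simp add: algebra_simps)
    hence "N (A x) = 0" by simp
    moreover have "N (A x) \<noteq> 0"
      by (rule quadrant_combination_nonvanishing[OF N nz]) (rule edge_image_pairwise_pos[OF ef _ _ x])
    ultimately show False by blast
  qed
  have bc: "bounded_clinear (\<lambda>x. \<nu> (A x))"
    using \<nu> A unfolding complex_dual_cone_def by (auto intro: bounded_clinear_compose)
  have E: "0 \<le> Re (\<nu> (A (\<iota>1 e)) * cnj (\<nu> (A (\<iota>1 f))))" if ef: "e \<in> E" "f \<in> E" for e f
  proof -
    have fin: "finite {A (\<iota>1 e), A (\<iota>1 f)}" by simp
    obtain c N where c: "c \<noteq> 0" and N: "\<And>k. N k \<in> quadrant_combinations"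
      and Nl: "\<And>y. y \<in> {A (\<iota>1 e), A (\<iota>1 f)} \<Longrightarrow> (\<lambda>k. N k y) \<longlonglongrightarrow> c * \<nu> y"
      using complex_dual_sequence[OF \<nu> fin] by blast
    have "(\<lambda>k. Re (N k (A (\<iota>1 e)) * cnj (N k (A (\<iota>1 f)))))
        \<longlonglongrightarrow> Re ((c * \<nu> (A (\<iota>1 e))) * cnj (c * \<nu> (A (\<iota>1 f))))"
      by (intro tendsto_intros Nl) auto
    hence "0 \<le> Re ((c * \<nu> (A (\<iota>1 e))) * cnj (c * \<nu> (A (\<iota>1 f))))"
      by (rule LIMSEQ_le_const) (use quad[OF N ef] in blast)
    also have "\<dots> = (cmod c)\<^sup>2 * Re (\<nu> (A (\<iota>1 e)) * cnj (\<nu> (A (\<iota>1 f))))"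
      unfolding cmod_power2 by (simp add: algebra_simps power2_eq_square)
    finally show ?thesis using c by (simp add: zero_le_mult_iff)
  qed
  show ?thesis
    unfolding complex_dual_cone_def using bc X1.pairwise_nonneg_extends[OF bc E] by blast
qed

section \<open>Contraction of the projective metric\<close>

text \<open>
  The functionals \<open>\<mu> \<circ> A\<close> and \<open>\<nu> \<circ> A\<close> lie in the complex dual cone of the first space, so \<open>t = |\<mu> (A x)| / |\<mu> (A y)|\<close> and
  \<open>s = |\<nu> (A x)| / |\<nu> (A y)|\<close> lie between \<open>1 / c\<close> and \<open>b\<close>. The pencil of \<open>x\<close> and \<open>y\<close> stays in the complexified cone in
  the directions \<open>x - z y\<close> with \<open>|z| > b\<close> and \<open>y - z x\<close> with \<open>|z| > c\<close>. Applying the diameter bound to two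
  such vectors compares the positions of \<open>s\<close> and \<open>t\<close> inside the interval, and the one-dimensional
  contraction concludes.
\<close>

lemma contracted_cross_ratio:
  assumes xy: "x \<in> X1.KC - {0}" "y \<in> X1.KC - {0}" and bc: "0 < b" "0 < c"
    and b: "\<And>\<mu>. \<mu> \<in> X1.KC' \<Longrightarrow> cmod (\<mu> x) \<le> b * cmod (\<mu> y)"
    and c: "\<And>\<mu>. \<mu> \<in> X1.KC' \<Longrightarrow> cmod (\<mu> y) \<le> c * cmod (\<mu> x)"
    and \<mu>\<nu>: "\<mu> \<in> X2.KC'" "\<nu> \<in> X2.KC'"
  shows "cmod (\<mu> (A x)) * cmod (\<nu> (A y)) \<le> exp (eta1 \<theta> * ln (b * c)) * (cmod (\<mu> (A y)) * cmod (\<nu> (A x)))"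
proof -
  define \<Delta> where "\<Delta> = 9 * delta1 \<theta>"
  have D0: "0 < D" using D_ge_1 by simp
  have expD: "exp \<Delta> = D ^ 9"
    unfolding \<Delta>_def delta1_def D_def[symmetric] using D0 exp_of_nat_mult[of 9 "ln D"] by simp
  have \<Delta>: "0 \<le> \<Delta>" unfolding \<Delta>_def delta1_def D_def[symmetric] using D_ge_1 by simp
  have eta: "eta1 \<theta> = tanh (\<Delta> / 4)" unfolding eta1_def \<Delta>_def by simp
  define p q p' q' where pq: "p = \<mu> (A x)" "q = \<mu> (A y)" "p' = \<nu> (A x)" "q' = \<nu> (A y)"
  note pb = pullback_in_complex_dual[OF \<mu>\<nu>(1)] pullback_in_complex_dual[OF \<mu>\<nu>(2)]
  have le: "cmod p \<le> b * cmod q" "cmod p' \<le> b * cmod q'" "cmod q \<le> c * cmod p" "cmod q' \<le> c * cmod p'"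
    unfolding pq using b[OF pb(1)] b[OF pb(2)] c[OF pb(1)] c[OF pb(2)] by auto
  have lin: "\<kappa> (A (u - z *\<^sub>C v)) = \<kappa> (A u) - z * \<kappa> (A v)" if "\<kappa> \<in> X2.KC'" for \<kappa> u v z
    using that A unfolding complex_dual_cone_def
    by (simp add: bounded_clinear_diff bounded_clinear_scaleC scaleC_complex_def)
  show ?thesis
  proof (cases "q = 0 \<or> q' = 0")
    case True
    thus ?thesis using le unfolding pq by auto
  next
    case False
    hence Y: "0 < cmod q" "0 < cmod q'" by auto
    hence X: "0 < cmod p" "0 < cmod p'" using le bc by (auto simp: zero_less_mult_iff intro: less_le_trans)
    define t s where "t = cmod p / cmod q" and "s = cmod p' / cmod q'"
    have ts: "0 < s" "0 < t" "s \<le> b" "t \<le> b" "1 / c \<le> s" "1 / c \<le> t"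
      unfolding t_def s_def using X Y le bc by (auto simp: field_simps)
    have XY: "cmod p = t * cmod q" "cmod p' = s * cmod q'" unfolding t_def s_def using Y by auto
    have \<eta>0: "0 \<le> eta1 \<theta>" unfolding eta using \<Delta> by simp
    have "t \<le> exp (eta1 \<theta> * ln (b * c)) * s"
    proof (cases "s \<le> t")
      case False
      have "1 / c \<le> b" using ts by linarith
      hence "1 \<le> b * c" using bc by (simp add: field_simps)
      hence "1 \<le> exp (eta1 \<theta> * ln (b * c))" using \<eta>0 by simp
      hence "s \<le> exp (eta1 \<theta> * ln (b * c)) * s" using ts(1) by simp
      thus ?thesis using False by linarith
    next
      case st: True
      have "ln (t / s) \<le> tanh (\<Delta> / 4) * ln (b / (1 / c))"
      proof (rule interval_hilbert_contraction_closed)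
        fix k :: real assume k: "1 < k"
        \<comment> \<open>The phases are chosen so that \<open>z2\<close> is aligned with \<open>\<mu> (A x) / \<mu> (A y)\<close> and \<open>1 / z1\<close> with \<open>\<nu> (A x) / \<nu> (A y)\<close>. Then two of
          the four values needed below are known exactly, and the triangle inequality bounds
          the other two in the right direction.\<close>
        define z2 where "z2 = of_real (b * k / t) * (p / q)"
        define z1 where "z1 = of_real (c * k * s) * (q' / p')"
        have nz: "p \<noteq> 0" "p' \<noteq> 0" "q \<noteq> 0" "q' \<noteq> 0" using X Y by auto
        have cz2: "cmod z2 = b * k" unfolding z2_def using bc k ts XY Y by (simp add: norm_mult norm_divide)
        have cz1: "cmod z1 = c * k" unfolding z1_def using bc k ts XY Y by (simp add: norm_mult norm_divide)
        have bk: "b < b * k" "c < c * k" using bc k by auto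
        have kt: "t < b * k" "s < b * k" using ts bk by linarith+
        have "1 \<le> c * s" using ts(5) bc by (simp add: field_simps)
        hence "k * 1 \<le> k * (c * s)" using k by (intro mult_left_mono) auto
        also have "\<dots> = c * k * s" by (simp add: mult_ac)
        finally have ks: "1 < c * k * s" using k by linarith
        have e11: "cmod (p - z2 * q) = cmod q * (b * k - t)"
        proof -
          have "p - z2 * q = of_real (1 - b * k / t) * p"
            unfolding z2_def using nz by (simp add: field_simps)
          hence "cmod (p - z2 * q) = \<bar>1 - b * k / t\<bar> * cmod p" by (simp only: norm_mult norm_of_real)
          also have "\<dots> = (b * k / t - 1) * (t * cmod q)" using kt ts XY by (simp add: abs_if field_simps)
          also have "\<dots> = cmod q * (b * k - t)" using ts by (simp add: field_simps)
          finally show ?thesis .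
        qed
        have e22: "cmod (q' - z1 * p') = cmod q' * (c * k * s - 1)"
        proof -
          have "q' - z1 * p' = of_real (1 - c * k * s) * q'"
            unfolding z1_def using nz by (simp add: field_simps)
          hence "cmod (q' - z1 * p') = \<bar>1 - c * k * s\<bar> * cmod q'" by (simp only: norm_mult norm_of_real)
          thus ?thesis using ks by simp
        qed
        have e12: "cmod q' * (b * k - s) \<le> cmod (p' - z2 * q')"
          using norm_triangle_ineq3[of "z2 * q'" p'] cz2 XY by (simp add: norm_mult norm_minus_commute algebra_simps)
        have e21: "cmod q * (c * k * t - 1) \<le> cmod (q - z1 * p)"
          using norm_triangle_ineq3[of "z1 * p" q] cz1 XY by (simp add: norm_mult norm_minus_commute algebra_simps)
        define w2 where "w2 = x - z2 *\<^sub>C y"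
        define w1 where "w1 = y - z1 *\<^sub>C x"
        have "w2 \<in> X1.KC" unfolding w2_def using xy b bk cz2 by (intro X1.pencil_in_cone[of _ _ b]) auto
        moreover have "w1 \<in> X1.KC" unfolding w1_def using xy c bk cz1 by (intro X1.pencil_in_cone[of _ _ c]) auto
        moreover have v: "\<mu> (A w1) = q - z1 * p" "\<mu> (A w2) = p - z2 * q"
          "\<nu> (A w1) = q' - z1 * p'" "\<nu> (A w2) = p' - z2 * q'"
          unfolding w1_def w2_def pq by (simp_all add: lin \<mu>\<nu>)
        moreover have "w2 \<noteq> 0"
        proof
          assume "w2 = 0"
          hence "\<mu> (A w2) = 0" using A \<mu>\<nu>(1) unfolding complex_dual_cone_def by (simp add: bounded_clinear_zero)
          thus False using v(2) e11 Y kt by simp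
        qed
        moreover have "w1 \<noteq> 0"
        proof
          assume "w1 = 0"
          hence "\<nu> (A w1) = 0" using A \<mu>\<nu>(2) unfolding complex_dual_cone_def by (simp add: bounded_clinear_zero)
          thus False using v(3) e22 Y ks by simp
        qed
        ultimately have "cmod (q - z1 * p) * cmod (p' - z2 * q')
            \<le> D ^ 9 * (cmod (q' - z1 * p') * cmod (p - z2 * q))"
          using cone_cross_ratio[OF \<mu>\<nu>, of w1 w2] by simp
        hence "cmod (q - z1 * p) * cmod (p' - z2 * q')
            \<le> D ^ 9 * ((cmod q' * (c * k * s - 1)) * (cmod q * (b * k - t)))"
          by (simp only: e11 e22)
        moreover have "(cmod q * (c * k * t - 1)) * (cmod q' * (b * k - s))
            \<le> cmod (q - z1 * p) * cmod (p' - z2 * q')"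
          using e12 e21 Y kt by (intro mult_mono) auto
        ultimately have "(cmod q * cmod q') * ((c * k * t - 1) * (b * k - s))
            \<le> (cmod q * cmod q') * (D ^ 9 * ((c * k * s - 1) * (b * k - t)))"
          by (simp add: mult_ac)
        hence main: "(c * k * t - 1) * (b * k - s) \<le> D ^ 9 * ((c * k * s - 1) * (b * k - t))"
          using Y by (simp add: mult_le_cancel_left)
        have "c * k * t - 1 = (c * k) * (t - 1 / c / k)" "c * k * s - 1 = (c * k) * (s - 1 / c / k)"
          using bc k by (simp_all add: field_simps)
        with main have "(c * k) * ((t - 1 / c / k) * (b * k - s)) \<le> (c * k) * (D ^ 9 * ((b * k - t) * (s - 1 / c / k)))"
          by (simp only: mult_ac)
        thus "(t - 1 / c / k) * (b * k - s) \<le> exp \<Delta> * ((b * k - t) * (s - 1 / c / k))"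
          unfolding expD using bc k by (simp only: mult_le_cancel_left_pos[OF mult_pos_pos[of c k]])
      qed (use ts st bc \<Delta> in auto)
      hence "ln (t / s) \<le> eta1 \<theta> * ln (b * c)" unfolding eta by simp
      hence "exp (ln (t / s)) \<le> exp (eta1 \<theta> * ln (b * c))" by simp
      thus ?thesis using ts by (simp add: field_simps)
    qed
    hence "(t * cmod q) * cmod q' \<le> (exp (eta1 \<theta> * ln (b * c)) * s) * cmod q * cmod q'"
      using Y by (intro mult_right_mono) auto
    thus ?thesis unfolding pq[symmetric] XY by (simp add: mult_ac)
  qed
qed

text \<open>
  If the distance of \<open>x\<close> and \<open>y\<close> is infinite, the right side is infinite as well, except for \<open>\<theta> = 0\<close>, where
  the factor is 0; then the diameter bound itself shows that the images have distance 0.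
\<close>

lemma image_dist_le:
  assumes xy: "x \<in> X1.KC - {0}" "y \<in> X1.KC - {0}"
  shows "projective_dist \<iota>2 K2 (A x) (A y) \<le> ereal (eta1 \<theta>) * projective_dist \<iota>1 K1 x y"
proof -
  obtain m where m: "m \<in> M" using M_nonempty by blast
  have nz: "pr m (A x) \<noteq> 0" "pr m (A y) \<noteq> 0"
    using edge_functional_nonvanishing[OF m m edge_functionals_ends(1)] xy by blast+
  have "m \<in> dual_cone K2" using M m unfolding weak_star_generating_set_def by blast
  hence mC: "pr m \<in> X2.KC'" by (rule X2.pairing_in_complex_dual)
  have mC1: "(\<lambda>x. pr m (A x)) \<in> X1.KC'" by (rule pullback_in_complex_dual[OF mC])
  show ?thesis
  proof (rule projective_dist_cases[OF mC1 nz])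
    assume inf: "projective_dist \<iota>1 K1 x y = \<infinity>"
    show ?thesis
    proof (cases "\<theta> = 0")
      case True
      hence "D = 1" "eta1 \<theta> = 0" unfolding D_def eta1_def delta1_def by simp_all
      hence "projective_dist \<iota>2 K2 (A x) (A y) \<le> ereal (ln 1)"
        using cone_cross_ratio[OF _ _ xy] by (intro projective_dist_le[OF mC nz]) (auto simp: mult.commute)
      thus ?thesis using \<open>eta1 \<theta> = 0\<close> by (simp flip: zero_ereal_def)
    next
      case False
      hence "0 < eta1 \<theta>" unfolding eta1_def delta1_def using \<theta> by simp
      thus ?thesis unfolding inf by simp
    qed
  next
    fix b c
    assume d: "projective_dist \<iota>1 K1 x y = ereal (ln (b * c))" and bc: "0 < b" "0 < c"
      "\<And>\<mu>. \<mu> \<in> X1.KC' \<Longrightarrow> cmod (\<mu> x) \<le> b * cmod (\<mu> y)"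
      "\<And>\<mu>. \<mu> \<in> X1.KC' \<Longrightarrow> cmod (\<mu> y) \<le> c * cmod (\<mu> x)"
    have "projective_dist \<iota>2 K2 (A x) (A y) \<le> ereal (ln (exp (eta1 \<theta> * ln (b * c))))"
      by (intro projective_dist_le[OF mC nz] contracted_cross_ratio[OF xy bc]) auto
    thus ?thesis unfolding d by simp
  qed
qed

end

theorem theorem2p9:
  fixes \<iota>1 :: "'r1::banach \<Rightarrow> 'c1::complex_banach"
    and \<iota>2 :: "'r2::banach \<Rightarrow> 'c2::complex_banach"
    and K1 :: "'r1 set" and K2 :: "'r2 set"
    and E1 :: "'r1 set" and M2 :: "('r2 \<Rightarrow>\<^sub>L real) set"
    and A :: "'c1 \<Rightarrow> 'c2" and \<theta> :: real
  assumes "complexification \<iota>1" and "complexification \<iota>2"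
    and X2_nontrivial: "\<exists>y::'r2. y \<noteq> 0"
    and "real_cone K1" and "real_cone K2"
    and "bounded_clinear A"
    and "generating_set K1 E1"
    and "weak_star_generating_set \<iota>2 K2 M2"
    and "archimedian K1 E1"
    and "0 \<le> \<theta>" and "\<theta> < 1"
    and "test_matrices \<iota>1 \<iota>2 A E1 M2 \<subseteq> Gamma_plus \<theta>"
  shows "A ` (cone_complexification \<iota>1 K1 - {0}) \<subseteq> cone_complexification \<iota>2 K2 - {0} \<and>
    (\<forall>x\<in>cone_complexification \<iota>1 K1 - {0}. \<forall>y\<in>cone_complexification \<iota>1 K1 - {0}.
       projective_dist \<iota>2 K2 (A x) (A y) \<le> ereal (eta1 \<theta>) * projective_dist \<iota>1 K1 x y)"
proof -
  interpret contraction_setting \<iota>1 K1 E1 \<iota>2 K2 M2 A \<theta>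
    by unfold_locales (fact assms)+
  show ?thesis
    by (intro conjI ballI image_subsetI image_in_cone image_dist_le)
qed

end
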